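(* There is an approximation-factor preserving reduction from SetCover to offline MinSet.
   Context: SetCover: given a ground set $U=\{1,\dots,n\}$ and a family $\bar{\mathcal{S}}$ of subsets of $U$, find $H\subseteq\bar{\mathcal{S}}$ of minimum cardinality with $\bigcup_{\bar S\in H}\bar S=U$. Offline MinSet: given intervals $\mathcal{I}=\{I_1,\dots,I_k\}$, each open $(L_i,U_i)$ with $L_i<U_i$ or trivial $\{w_i\}$ with $L_i=U_i=w_i$, together with all values $w_i\in I_i$, and a family $\mathcal{S}$ of subsets of $\mathcal{I}$, find a feasible set $Q\subseteq\mathcal{I}$ of minimum cardinality, where, with $w(S)=\sum_{I_i\in S}w_i$, $w^*=\min_S w(S)$, $L_S(Q)=\sum_{I_i\in S\setminus Q}L_i+\sum_{I_i\in S\cap Q}w_i$ and $U_S(Q)=\sum_{I_i\in S\setminus Q}U_i+\sum_{I_i\in S\cap Q}w_i$, $Q$ is feasible if some $S^*\in\mathcal{S}$ has $L_{S^*}(Q)=U_{S^*}(Q)=w^*$ and $L_S(Q)\ge w^*$ for all $S\in\mathcal{S}$. An approximation-factor preserving reduction from problem $\Pi_1$ to minimization problem $\Pi_2$ consists of polynomial-time maps $f$ (instances of $\Pi_1$ to instances of $\Pi_2$) and $g$ (feasible solutions of $f(I)$ to feasible solutions of $I$) such that $\mathrm{OPT}_{\Pi_2}(f(I))\le\mathrm{OPT}_{\Pi_1}(I)$ and the cost of $g(Q)$ is at most the cost of $Q$ for every feasible $Q$ of $f(I)$. *)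

theory Defs
  imports Complex_Main "HOL-Library.Extended_Nat" "HOL-Computational_Algebra.Polynomial"
begin

section \<open>Polynomial time\<close>

text \<open>
  The machine model is the WHILE language of Jones (Computability and Complexity from a
  Programming Perspective) over binary trees. Every evaluation of a subexpression is charged the
  size of the tree it produces (not one unit as with shared trees), so that the
  running time bounds the size of all data and the functions computable in polynomial time are those
  of Turing machines.
\<close>

datatype tree = Leaf | Node tree tree

fun tsize :: "tree \<Rightarrow> nat" where
  "tsize Leaf = 1"
| "tsize (Node a b) = 1 + tsize a + tsize b"

type_synonym store = "nat \<Rightarrow> tree"

datatype expr =
    Var nat
  | Const tree
  | Pair expr expr
  | Fst expr
  | Snd expr
  | Equal expr expr

fun left :: "tree \<Rightarrow> tree" where
  "left Leaf = Leaf"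
| "left (Node a b) = a"

fun right :: "tree \<Rightarrow> tree" where
  "right Leaf = Leaf"
| "right (Node a b) = b"

fun enc_bool :: "bool \<Rightarrow> tree" where
  "enc_bool False = Leaf"
| "enc_bool True = Node Leaf Leaf"

fun eval_expr :: "expr \<Rightarrow> store \<Rightarrow> tree" where
  "eval_expr (Var x) s = s x"
| "eval_expr (Const d) s = d"
| "eval_expr (Pair e1 e2) s = Node (eval_expr e1 s) (eval_expr e2 s)"
| "eval_expr (Fst e) s = left (eval_expr e s)"
| "eval_expr (Snd e) s = right (eval_expr e s)"
| "eval_expr (Equal e1 e2) s = enc_bool (eval_expr e1 s = eval_expr e2 s)"

fun expr_time :: "expr \<Rightarrow> store \<Rightarrow> nat" where
  "expr_time (Var x) s = tsize (s x)"
| "expr_time (Const d) s = tsize d"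
| "expr_time (Pair e1 e2) s =
     expr_time e1 s + expr_time e2 s + tsize (eval_expr (Pair e1 e2) s)"
| "expr_time (Fst e) s = expr_time e s + tsize (eval_expr (Fst e) s)"
| "expr_time (Snd e) s = expr_time e s + tsize (eval_expr (Snd e) s)"
| "expr_time (Equal e1 e2) s =
     expr_time e1 s + expr_time e2 s + tsize (eval_expr (Equal e1 e2) s)"

datatype com =
    Skip
  | Assign nat expr
  | Seq com com
  | If expr com com
  | While expr com

text \<open>\<open>exec c s t s'\<close>: started in \<open>s\<close>, the program \<open>c\<close> terminates in \<open>s'\<close> after time \<open>t\<close>.
  A guard counts as true unless it evaluates to \<open>Leaf\<close>.\<close>

inductive exec :: "com \<Rightarrow> store \<Rightarrow> nat \<Rightarrow> store \<Rightarrow> bool" where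
  Skip: "exec Skip s 1 s"
| Assign: "exec (Assign x e) s (1 + expr_time e s) (s(x := eval_expr e s))"
| Seq: "exec c1 s t1 s1 \<Longrightarrow> exec c2 s1 t2 s2 \<Longrightarrow> exec (Seq c1 c2) s (1 + t1 + t2) s2"
| IfTrue: "eval_expr e s \<noteq> Leaf \<Longrightarrow> exec c1 s t s' \<Longrightarrow>
    exec (If e c1 c2) s (1 + expr_time e s + t) s'"
| IfFalse: "eval_expr e s = Leaf \<Longrightarrow> exec c2 s t s' \<Longrightarrow>
    exec (If e c1 c2) s (1 + expr_time e s + t) s'"
| WhileFalse: "eval_expr e s = Leaf \<Longrightarrow> exec (While e c) s (1 + expr_time e s) s"
| WhileTrue: "eval_expr e s \<noteq> Leaf \<Longrightarrow> exec c s t1 s1 \<Longrightarrow> exec (While e c) s1 t2 s2 \<Longrightarrow>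
    exec (While e c) s (1 + expr_time e s + t1 + t2) s2"

definition init_store :: "tree \<Rightarrow> store" where
  "init_store d = (\<lambda>x. if x = 0 then d else Leaf)"

text \<open>Input and output are held in variable 0.\<close>

definition poly_time_on :: "'a set \<Rightarrow> ('a \<Rightarrow> tree) \<Rightarrow> ('b \<Rightarrow> tree) \<Rightarrow> ('a \<Rightarrow> 'b) \<Rightarrow> bool" where
  "poly_time_on D enc_in enc_out h \<longleftrightarrow>
    (\<exists>(c :: com) (p :: nat poly). \<forall>x\<in>D. \<exists>t s.
       exec c (init_store (enc_in x)) t s \<and>
       s 0 = enc_out (h x) \<and>
       t \<le> poly p (tsize (enc_in x)))"


section \<open>Encodings\<close>

text \<open>Binary, least significant bit first, without leading zeros.\<close>

fun enc_nat :: "nat \<Rightarrow> tree" where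
  "enc_nat n = (if n = 0 then Leaf else Node (enc_bool (odd n)) (enc_nat (n div 2)))"

declare enc_nat.simps [simp del]

definition enc_int :: "int \<Rightarrow> tree" where
  "enc_int i = Node (enc_bool (i < 0)) (enc_nat (nat \<bar>i\<bar>))"

definition enc_prod :: "('a \<Rightarrow> tree) \<Rightarrow> ('b \<Rightarrow> tree) \<Rightarrow> 'a \<times> 'b \<Rightarrow> tree" where
  "enc_prod ea eb = (\<lambda>(a, b). Node (ea a) (eb b))"

definition enc_rat :: "rat \<Rightarrow> tree" where
  "enc_rat r = enc_prod enc_int enc_int (quotient_of r)"

fun enc_list :: "('a \<Rightarrow> tree) \<Rightarrow> 'a list \<Rightarrow> tree" where
  "enc_list e [] = Leaf"
| "enc_list e (x # xs) = Node (e x) (enc_list e xs)"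

lemma enc_bool_inject [simp]: "enc_bool a = enc_bool b \<longleftrightarrow> a = b"
  by (cases a; cases b) auto

lemma inj_enc_nat: "inj enc_nat"
proof (rule injI)
  fix m n :: nat
  show "enc_nat m = enc_nat n \<Longrightarrow> m = n"
  proof (induction m arbitrary: n rule: less_induct)
    case (less m)
    show ?case
    proof (cases "m = 0 \<or> n = 0")
      case True
      then show ?thesis
        using less.prems by (auto simp: enc_nat.simps[of m] enc_nat.simps[of n] split: if_splits)
    next
      case False
      then have "odd m = odd n" "enc_nat (m div 2) = enc_nat (n div 2)"
        using less.prems by (auto simp: enc_nat.simps[of m] enc_nat.simps[of n])
      moreover from this have "m div 2 = n div 2"
        using less.IH[of "m div 2" "n div 2"] False by simp
      ultimately show ?thesis
        by (metis bit_eq_rec)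
    qed
  qed
qed

lemma inj_enc_int: "inj enc_int"
proof (rule injI)
  fix i j :: int
  assume "enc_int i = enc_int j"
  then have "(i < 0) = (j < 0)" "nat \<bar>i\<bar> = nat \<bar>j\<bar>"
    by (auto simp: enc_int_def dest: injD[OF inj_enc_nat])
  then show "i = j" by linarith
qed

lemma inj_enc_prod: "inj ea \<Longrightarrow> inj eb \<Longrightarrow> inj (enc_prod ea eb)"
  by (auto simp: enc_prod_def inj_def)

lemma inj_enc_rat: "inj enc_rat"
  unfolding enc_rat_def
  by (rule injI)
    (auto dest: injD[OF inj_enc_prod[OF inj_enc_int inj_enc_int]] intro: quotient_of_inject)

lemma inj_enc_list:
  assumes "inj e"
  shows "inj (enc_list e)"
proof (rule injI)
  fix xs ys
  show "enc_list e xs = enc_list e ys \<Longrightarrow> xs = ys"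
  proof (induction xs arbitrary: ys)
    case Nil
    then show ?case by (cases ys) auto
  next
    case (Cons x xs)
    then show ?case using assms by (cases ys) (auto dest: injD)
  qed
qed


section \<open>Minimization problems and reductions\<close>

text \<open>Elements of \<open>'i\<close> and \<open>'s\<close> are the concrete presentations of instances and solutions that an
  algorithm reads and writes; \<open>solutions P x\<close> are the feasible ones for \<open>x\<close>.\<close>

record ('i, 's) min_problem =
  instances :: "'i set"
  solutions :: "'i \<Rightarrow> 's set"
  cost :: "'i \<Rightarrow> 's \<Rightarrow> nat"
  enc_inst :: "'i \<Rightarrow> tree"
  enc_sol :: "'s \<Rightarrow> tree"

text \<open>The optimum is \<open>\<infinity>\<close> for instances without feasible solution.\<close>

definition OPT :: "('i, 's) min_problem \<Rightarrow> 'i \<Rightarrow> enat" where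
  "OPT P x = (INF s\<in>solutions P x. enat (cost P x s))"

definition approx_factor_preserving_reduction ::
  "('i1, 's1) min_problem \<Rightarrow> ('i2, 's2) min_problem \<Rightarrow>
   ('i1 \<Rightarrow> 'i2) \<Rightarrow> ('i1 \<Rightarrow> 's2 \<Rightarrow> 's1) \<Rightarrow> bool" where
  "approx_factor_preserving_reduction P1 P2 f g \<longleftrightarrow>
    poly_time_on (instances P1) (enc_inst P1) (enc_inst P2) f \<and>
    poly_time_on {(x, s). x \<in> instances P1 \<and> s \<in> solutions P2 (f x)}
      (enc_prod (enc_inst P1) (enc_sol P2)) (enc_sol P1) (\<lambda>(x, s). g x s) \<and>
    (\<forall>x\<in>instances P1.
       f x \<in> instances P2 \<and>
       OPT P2 (f x) \<le> OPT P1 x \<and>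
       (\<forall>s\<in>solutions P2 (f x).
          g x s \<in> solutions P1 x \<and> cost P1 x (g x s) \<le> cost P2 (f x) s))"


section \<open>Set cover\<close>

definition is_cover :: "nat \<Rightarrow> nat set set \<Rightarrow> nat set set \<Rightarrow> bool" where
  "is_cover n \<S> H \<longleftrightarrow> H \<subseteq> \<S> \<and> \<Union>H = {1..n}"

text \<open>The set family presented by a list of lists; neither order nor repetitions matter.\<close>

definition family :: "nat list list \<Rightarrow> nat set set" where
  "family xss = set ` set xss"

text \<open>The ground set is part of the input as a list of its elements, so the size of an instance
  is at least \<open>n\<close>.\<close>

definition SetCover :: "(nat \<times> nat list list, nat list list) min_problem" where
  "SetCover = \<lparr>
     instances = {(n, ss). family ss \<subseteq> Pow {1..n}},
     solutions = (\<lambda>(n, ss). {hs. is_cover n (family ss) (family hs)}),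
     cost = (\<lambda>_ hs. card (family hs)),
     enc_inst = (\<lambda>(n, ss).
       enc_prod (enc_list enc_nat) (enc_list (enc_list enc_nat)) ([1..<Suc n], ss)),
     enc_sol = enc_list (enc_list enc_nat)\<rparr>"


section \<open>Offline MinSet\<close>

text \<open>Intervals are identified by their indices \<open>i \<in> {1..k}\<close>, so that several intervals may
  have the same endpoints. Interval \<open>i\<close> has endpoints \<open>L i\<close>, \<open>U i\<close> and value \<open>w i\<close>.\<close>

definition valid_interval :: "rat \<Rightarrow> rat \<Rightarrow> rat \<Rightarrow> bool" where
  "valid_interval l u v \<longleftrightarrow> (l < u \<and> v \<in> {l<..<u}) \<or> (l = u \<and> v = l)"

definition set_weight :: "(nat \<Rightarrow> rat) \<Rightarrow> nat set \<Rightarrow> rat" where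
  "set_weight w S = (\<Sum>i\<in>S. w i)"

definition min_weight :: "(nat \<Rightarrow> rat) \<Rightarrow> nat set set \<Rightarrow> rat" where
  "min_weight w \<S> = Min (set_weight w ` \<S>)"

text \<open>\<open>L\<^sub>S(Q)\<close> and \<open>U\<^sub>S(Q)\<close> are \<open>queried_bound L w S Q\<close> and \<open>queried_bound U w S Q\<close>.\<close>

definition queried_bound ::
  "(nat \<Rightarrow> rat) \<Rightarrow> (nat \<Rightarrow> rat) \<Rightarrow> nat set \<Rightarrow> nat set \<Rightarrow> rat" where
  "queried_bound B w S Q = (\<Sum>i\<in>S - Q. B i) + (\<Sum>i\<in>S \<inter> Q. w i)"

definition minset_feasible ::
  "nat \<Rightarrow> (nat \<Rightarrow> rat) \<Rightarrow> (nat \<Rightarrow> rat) \<Rightarrow> (nat \<Rightarrow> rat) \<Rightarrow> nat set set \<Rightarrow> nat set \<Rightarrow> bool" where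
  "minset_feasible k L U w \<S> Q \<longleftrightarrow>
    Q \<subseteq> {1..k} \<and>
    (\<exists>S\<in>\<S>. queried_bound L w S Q = min_weight w \<S> \<and> queried_bound U w S Q = min_weight w \<S>) \<and>
    (\<forall>S\<in>\<S>. queried_bound L w S Q \<ge> min_weight w \<S>)"

text \<open>An instance lists the triples \<open>(L\<^sub>i, U\<^sub>i, w\<^sub>i)\<close> for \<open>i = 1, \<dots>, k\<close> and the family.
  For an empty family \<open>min_weight\<close> is unspecified, but then no \<open>Q\<close> is feasible anyway.\<close>

type_synonym minset_instance = "(rat \<times> rat \<times> rat) list \<times> nat list list"

definition lower_end :: "(rat \<times> rat \<times> rat) list \<Rightarrow> nat \<Rightarrow> rat" where
  "lower_end iv i = fst (iv ! (i - 1))"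

definition upper_end :: "(rat \<times> rat \<times> rat) list \<Rightarrow> nat \<Rightarrow> rat" where
  "upper_end iv i = fst (snd (iv ! (i - 1)))"

definition weight :: "(rat \<times> rat \<times> rat) list \<Rightarrow> nat \<Rightarrow> rat" where
  "weight iv i = snd (snd (iv ! (i - 1)))"

definition OfflineMinSet :: "(minset_instance, nat list) min_problem" where
  "OfflineMinSet = \<lparr>
     instances = {(iv, ss).
       (\<forall>i\<in>{1..length iv}. valid_interval (lower_end iv i) (upper_end iv i) (weight iv i)) \<and>
       family ss \<subseteq> Pow {1..length iv}},
     solutions = (\<lambda>(iv, ss).
       {qs. minset_feasible (length iv) (lower_end iv) (upper_end iv) (weight iv)
              (family ss) (set qs)}),
     cost = (\<lambda>_ qs. card (set qs)),
     enc_inst = enc_prod (enc_list (enc_prod enc_rat (enc_prod enc_rat enc_rat)))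
                  (enc_list (enc_list enc_nat)),
     enc_sol = enc_list enc_nat\<rparr>"

end

theory Submission imports Defs begin

text \<open>
  Each of the \<open>m\<close> sets of the cover instance becomes an interval \<open>(0, 2)\<close> of value 1, and one further
  trivial interval \<open>{1}\<close> is added. The family consists of the singleton of the trivial interval and,
  for every element \<open>i\<close>, of the set \<open>S\<^sub>i\<close> of the indices of the sets containing \<open>i\<close>. If no \<open>S\<^sub>i\<close> is empty, then
  \<open>w* = 1\<close> is attained with certainty at the singleton, and the lower bound of \<open>S\<^sub>i\<close> after the queries
  \<open>Q\<close> is \<open>|S\<^sub>i \<inter> Q|\<close>; so \<open>Q\<close> is feasible iff it meets every \<open>S\<^sub>i\<close>, that is, iff the queried sets form a cover.

  For the running times, all data are bounded by a polynomial \<open>B\<close> of the input size, and every loop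
  runs over a list of length at most \<open>B\<close>.
\<close>

section \<open>Time-bounded execution\<close>

text \<open>Total correctness with a budget: \<open>T\<close> only bounds the time from above, so
  branches of different cost can share a budget and budgets can be rounded up.\<close>

definition run :: "com \<Rightarrow> store \<Rightarrow> nat \<Rightarrow> (store \<Rightarrow> bool) \<Rightarrow> bool" where
  "run c s T Q \<longleftrightarrow> (\<exists>t s'. exec c s t s' \<and> t \<le> T \<and> Q s')"

lemma run_mono: "run c s T Q \<Longrightarrow> T \<le> T' \<Longrightarrow> (\<And>s'. Q s' \<Longrightarrow> Q' s') \<Longrightarrow> run c s T' Q'"
  unfolding run_def by (meson le_trans)

lemma run_Skip: "Q s \<Longrightarrow> 1 \<le> T \<Longrightarrow> run Skip s T Q"
  unfolding run_def by (blast intro: exec.Skip)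

lemma run_Assign: "Q (s(x := eval_expr e s)) \<Longrightarrow> run (Assign x e) s (1 + expr_time e s) Q"
  unfolding run_def by (blast intro: exec.Assign)

text \<open>The postcondition of \<open>c1\<close> is itself a \<open>run\<close> claim about
  \<open>c2\<close>, so long sequences are handled by repeated backward application, without naming
  intermediate assertions.\<close>

lemma run_Seq: "run c1 s T1 (\<lambda>s1. run c2 s1 T2 Q) \<Longrightarrow> run (Seq c1 c2) s (1 + T1 + T2) Q"
  unfolding run_def by (meson exec.Seq add_le_mono le_refl)

lemma run_If:
  assumes "eval_expr e s \<noteq> Leaf \<Longrightarrow> run c1 s T Q" "eval_expr e s = Leaf \<Longrightarrow> run c2 s T Q"
  shows "run (If e c1 c2) s (1 + expr_time e s + T) Q"
  using assms unfolding run_def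
  by (cases "eval_expr e s = Leaf") (meson exec.IfTrue exec.IfFalse add_le_cancel_left)+

lemma run_While_False:
  "eval_expr e s = Leaf \<Longrightarrow> Q s \<Longrightarrow> run (While e c) s (1 + expr_time e s) Q"
  unfolding run_def by (blast intro: exec.WhileFalse)

lemma run_While_True:
  "eval_expr e s \<noteq> Leaf \<Longrightarrow> run c s T1 (\<lambda>s1. run (While e c) s1 T2 Q) \<Longrightarrow>
    run (While e c) s (1 + expr_time e s + T1 + T2) Q"
  unfolding run_def by (metis exec.WhileTrue add_le_mono add_le_cancel_left)

lemma run_Assign_le:
  "Q (s(x := eval_expr e s)) \<Longrightarrow> 1 + expr_time e s \<le> T \<Longrightarrow> run (Assign x e) s T Q"
  by (rule run_mono[OF run_Assign])

text \<open>The invariant is indexed by the part of the list still to be processed, and the proof is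
  by induction on it. A round costs 1, a guard of size at most \<open>B\<close>, and
  \<open>T\<close>; the final 2 pays for the failing guard, which reads a
  \<open>Leaf\<close>.\<close>

lemma run_foreach:
  assumes step: "\<And>x xs s. I (x # xs) s \<Longrightarrow> s v \<noteq> Leaf \<and> tsize (s v) \<le> B \<and> run body s T (I xs)"
    and stop: "\<And>s. I [] s \<Longrightarrow> s v = Leaf"
  shows "I xs s \<Longrightarrow> run (While (Var v) body) s (length xs * (1 + B + T) + 2) (I [])"
proof (induction xs arbitrary: s)
  case Nil
  then show ?case by (intro run_mono[OF run_While_False[where Q = "I []"]]) (auto dest: stop)
next
  case (Cons x xs)
  note st = step[OF Cons.prems]
  have "run (While (Var v) body) s
          (1 + expr_time (Var v) s + T + (length xs * (1 + B + T) + 2)) (I [])"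
  proof (rule run_While_True)
    show "eval_expr (Var v) s \<noteq> Leaf" using st by simp
    show "run body s T (\<lambda>s1. run (While (Var v) body) s1 (length xs * (1 + B + T) + 2) (I []))"
      by (rule run_mono[OF conjunct2[OF conjunct2[OF st]] le_refl Cons.IH])
  qed
  then show ?case by (rule run_mono) (use st in auto)
qed


section \<open>Sizes of encodings\<close>

lemma tsize_pos: "0 < tsize t"
  by (cases t) auto

lemma tsize_enc_list: "tsize (enc_list e xs) = Suc (\<Sum>x\<leftarrow>xs. Suc (tsize (e x)))"
  by (induction xs) auto

lemma tsize_enc_bool: "tsize (enc_bool b) \<le> 3"
  by (cases b) auto

lemma enc_bool_eq_Leaf: "enc_bool b = Leaf \<longleftrightarrow> \<not> b"
  by (cases b) auto

lemma enc_list_eq_Leaf: "enc_list e xs = Leaf \<longleftrightarrow> xs = []"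
  by (cases xs) auto

text \<open>A digit adds at most 4 and \<open>n div 2 < n\<close>. The bound is crude, but it is
  applied only to interval indices, which are themselves bounded by the input size.\<close>

lemma tsize_enc_nat: "tsize (enc_nat n) \<le> 4 * n + 1"
proof (induction n rule: less_induct)
  case (less n)
  show ?case
  proof (cases "n = 0")
    case False
    then have "n div 2 < n" by simp
    with less.IH[OF this] tsize_enc_bool[of "odd n"] False show ?thesis
      by (simp add: enc_nat.simps[of n])
  qed (simp add: enc_nat.simps[of 0])
qed

lemma tsize_enc_list_le:
  assumes "\<And>x. x \<in> set xs \<Longrightarrow> tsize (e x) \<le> b" "length xs \<le> n"
  shows "tsize (enc_list e xs) \<le> n * (b + 1) + 1"
proof -
  have "tsize (enc_list e xs) \<le> length xs * (b + 1) + 1"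
    using assms(1)
  proof (induction xs)
    case (Cons x xs)
    then have "tsize (e x) \<le> b" "tsize (enc_list e xs) \<le> length xs * (b + 1) + 1" by auto
    then show ?case by simp
  qed simp
  also have "\<dots> \<le> n * (b + 1) + 1" using assms(2) by (simp add: mult_le_mono1 del: mult_Suc_right)
  finally show ?thesis .
qed

lemma length_less_tsize: "length xs < tsize (enc_list e xs)"
  by (induction xs) auto

lemma tsize_member_le: "x \<in> set xs \<Longrightarrow> tsize (e x) \<le> tsize (enc_list e xs)"
  by (induction xs) auto


section \<open>Program fragments\<close>

fun inc_tree :: "tree \<Rightarrow> tree" where
  "inc_tree Leaf = Node (Node Leaf Leaf) Leaf"
| "inc_tree (Node Leaf r) = Node (Node Leaf Leaf) r"
| "inc_tree (Node (Node a b) r) = Node Leaf (inc_tree r)"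

text \<open>For odd \<open>n\<close> the carry passes to \<open>n div 2\<close>, since then
  \<open>Suc n div 2 = Suc (n div 2)\<close>; for even \<open>n\<close> only the lowest digit
  changes.\<close>

lemma inc_tree_enc_nat: "inc_tree (enc_nat n) = enc_nat (Suc n)"
proof (induction n rule: less_induct)
  case (less n)
  show ?case
  proof (cases "n = 0")
    case False
    then have "inc_tree (enc_nat (n div 2)) = enc_nat (Suc (n div 2))" by (intro less.IH) simp
    with False show ?thesis
      by (cases "even n") (simp_all add: enc_nat.simps[of n] enc_nat.simps[of "Suc n"])
  qed (simp add: enc_nat.simps[of 0] enc_nat.simps[of "Suc 0"])
qed

text \<open>Variable 12 is incremented: the trailing ones are moved to variable 2 in unary and come back
  as zeros.\<close>

abbreviation strip_ones :: com where
  "strip_ones \<equiv> While (Fst (Var 12))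
     (Seq (Assign 2 (Pair (Const Leaf) (Var 2))) (Assign 12 (Snd (Var 12))))"

abbreviation push_zeros :: com where
  "push_zeros \<equiv> While (Var 2)
     (Seq (Assign 12 (Pair (Const Leaf) (Var 12))) (Assign 2 (Snd (Var 2))))"

text \<open>After stripping, variable 12 starts with a zero or is \<open>Leaf\<close>. As
  \<open>Snd\<close> of \<open>Leaf\<close> is \<open>Leaf\<close>, the same assignment flips that
  zero or appends a new leading one.\<close>

definition increment :: com where
  "increment = Seq (Assign 2 (Const Leaf)) (Seq strip_ones
     (Seq (Assign 12 (Pair (Const (Node Leaf Leaf)) (Snd (Var 12)))) push_zeros))"

text \<open>The third case of the recursion of \<open>inc_tree\<close> is one round of the loop. Of
  the \<open>k\<close> stripped digits each has size at least 4 but adds only 2 to variable 2, so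
  the joint size of both variables stays below \<open>B\<close>.\<close>

lemma run_strip_ones:
  assumes "s 12 = t" "tsize t + tsize (s 2) \<le> B"
  shows "run strip_ones s (tsize t * (10 * B + 10)) (\<lambda>s'. \<exists>k.
      s' 2 = (Node Leaf ^^ k) (s 2) \<and>
      inc_tree t = (Node Leaf ^^ k) (Node (Node Leaf Leaf) (right (s' 12))) \<and>
      tsize (s' 12) + 4 * k \<le> tsize t \<and> (\<forall>v. v \<notin> {2, 12} \<longrightarrow> s' v = s v))"
  using assms
proof (induction t arbitrary: s rule: inc_tree.induct)
  case 1
  then show ?case
    by (intro run_mono[OF run_While_False[where Q = "\<lambda>s'. s' = s"]])
      (auto intro!: exI[of _ "0::nat"])
next
  case (2 r)
  then show ?case
    by (intro run_mono[OF run_While_False[where Q = "\<lambda>s'. s' = s"]])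
      (auto intro!: exI[of _ "0::nat"])
next
  case (3 a b r)
  let ?s = "s(2 := Node Leaf (s 2), 12 := r)"
  have *: "run strip_ones ?s (tsize r * (10 * B + 10)) (\<lambda>s'. \<exists>k.
      s' 2 = (Node Leaf ^^ k) (s 2) \<and>
      inc_tree (Node (Node a b) r) =
        (Node Leaf ^^ k) (Node (Node Leaf Leaf) (right (s' 12))) \<and>
      tsize (s' 12) + 4 * k \<le> tsize (Node (Node a b) r) \<and> (\<forall>v. v \<notin> {2, 12} \<longrightarrow> s' v = s v))"
  proof (rule run_mono[OF 3(1)[of ?s] le_refl], goal_cases)
    case (3 s')
    then obtain k where k: "s' 2 = (Node Leaf ^^ k) (Node Leaf (s 2))"
      "inc_tree r = (Node Leaf ^^ k) (Node (Node Leaf Leaf) (right (s' 12)))"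
      "tsize (s' 12) + 4 * k \<le> tsize r" "\<forall>v. v \<notin> {2, 12} \<longrightarrow> s' v = s v"
      by auto
    have "tsize (s' 12) + 4 * Suc k \<le> tsize (Node (Node a b) r)"
      using k(3) tsize_pos[of a] tsize_pos[of b] by simp
    moreover have "s' 2 = (Node Leaf ^^ Suc k) (s 2)" using k(1) by (simp add: funpow_swap1)
    ultimately show ?case using k(2,4) by (intro exI[of _ "Suc k"]) simp
  next
    case 2
    then show ?case using 3(3) tsize_pos[of a] tsize_pos[of b] by simp
  qed simp
  \<comment> \<open>The budget is \<open>10 * B + 10\<close> per unit of size, so the stripped root
    node alone pays for this round.\<close>
  have "tsize (Node (Node a b) r) * (10 * B + 10) =
      tsize (Node a b) * (10 * B + 10) + (10 * B + 10) + tsize r * (10 * B + 10)"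
    by (simp only: tsize.simps(2) ring_distribs mult_1)
  then have le: "10 * B + 10 + tsize r * (10 * B + 10) \<le> tsize (Node (Node a b) r) * (10 * B + 10)"
    by linarith
  have "run strip_ones s (1 + expr_time (Fst (Var 12)) s + (1 + (2 * B + 4) + (2 * B + 1)) +
      tsize r * (10 * B + 10)) (\<lambda>s'. \<exists>k. s' 2 = (Node Leaf ^^ k) (s 2) \<and>
      inc_tree (Node (Node a b) r) =
        (Node Leaf ^^ k) (Node (Node Leaf Leaf) (right (s' 12))) \<and>
      tsize (s' 12) + 4 * k \<le> tsize (Node (Node a b) r) \<and> (\<forall>v. v \<notin> {2, 12} \<longrightarrow> s' v = s v))"
    using * 3(2,3) by (intro run_While_True run_Seq run_Assign_le) simp_all
  then show ?case by (rule run_mono[OF _ order_trans[OF _ le]]) (use 3(2,3) in simp_all)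
qed

text \<open>Each round trades a unit of the counter, of size 2, for a zero digit of size 2, which
  keeps \<open>tsize (s 12) + 2 * k\<close> constant. The factor is \<open>Suc k\<close> to pay for
  the last guard.\<close>

lemma run_push_zeros:
  assumes "s 2 = (Node Leaf ^^ k) Leaf" "tsize (s 12) + 2 * k \<le> B"
  shows "run push_zeros s (Suc k * (10 * B + 20))
    (\<lambda>s'. s' 12 = (Node Leaf ^^ k) (s 12) \<and> (\<forall>v. v \<notin> {2, 12} \<longrightarrow> s' v = s v))"
  using assms
proof (induction k arbitrary: s)
  case 0
  then show ?case by (intro run_mono[OF run_While_False[where Q = "\<lambda>s'. s' = s"]]) auto
next
  case (Suc k)
  have sz: "tsize ((Node Leaf ^^ k) Leaf) = 2 * k + 1" by (induction k) auto
  let ?s = "s(12 := Node Leaf (s 12), 2 := (Node Leaf ^^ k) Leaf)"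
  have *: "run push_zeros ?s (Suc k * (10 * B + 20))
      (\<lambda>s'. s' 12 = (Node Leaf ^^ Suc k) (s 12) \<and> (\<forall>v. v \<notin> {2, 12} \<longrightarrow> s' v = s v))"
    by (rule run_mono[OF Suc.IH[of ?s] le_refl]) (use Suc.prems in \<open>auto simp: funpow_swap1\<close>)
  have "run push_zeros s (1 + expr_time (Var 2) s + (1 + (2 * B + 4) + (2 * B + 4)) +
      Suc k * (10 * B + 20))
      (\<lambda>s'. s' 12 = (Node Leaf ^^ Suc k) (s 12) \<and> (\<forall>v. v \<notin> {2, 12} \<longrightarrow> s' v = s v))"
    using * Suc.prems sz by (intro run_While_True run_Seq run_Assign_le) simp_all
  then show ?case by (rule run_mono) (use Suc.prems sz in simp_all)
qed

lemma run_increment: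
  assumes "tsize (s 12) \<le> B"
  shows "run increment s ((B + 5) * (20 * B + 200))
    (\<lambda>s'. s' 12 = inc_tree (s 12) \<and> (\<forall>v. v \<notin> {2, 12} \<longrightarrow> s' v = s v))"
proof -
  let ?Q = "\<lambda>s'. s' 12 = inc_tree (s 12) \<and> (\<forall>v. v \<notin> {2, 12} \<longrightarrow> s' v = s v)"
  let ?c = "Seq (Assign 12 (Pair (Const (Node Leaf Leaf)) (Snd (Var 12)))) push_zeros"
  let ?T = "1 + (4 * B + 20) + Suc B * (10 * (B + 5) + 20)"
  have "run ?c s' ?T ?Q"
    if 2: "s' 2 = (Node Leaf ^^ k) Leaf"
      and inc: "inc_tree (s 12) = (Node Leaf ^^ k) (Node (Node Leaf Leaf) (right (s' 12)))"
      and sz: "tsize (s' 12) + 4 * k \<le> tsize (s 12)"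
      and fr: "\<forall>v. v \<notin> {2, 12} \<longrightarrow> s' v = s v" for s' k
  proof -
    let ?s = "s'(12 := Node (Node Leaf Leaf) (right (s' 12)))"
    have r: "tsize (right (s' 12)) \<le> tsize (s' 12)" by (cases "s' 12") auto
    \<comment> \<open>Writing the digit one adds at most 4 to variable 12, and the \<open>k\<close>
      zeros add \<open>2 * k\<close>, less than what stripping removed when \<open>k > 0\<close>; so
      \<open>B + 5\<close> bounds the data.\<close>
    have "Suc k * (10 * (B + 5) + 20) \<le> Suc B * (10 * (B + 5) + 20)"
      using sz assms by (intro mult_le_mono1) simp
    then have "run push_zeros ?s (Suc B * (10 * (B + 5) + 20)) ?Q"
      by (rule run_mono[OF run_push_zeros[of ?s k "B + 5"], rotated 2])
        (use 2 fr sz r assms inc in auto)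
    then show ?thesis
      by (intro run_Seq run_Assign_le) (use sz r assms in auto)
  qed
  \<comment> \<open>The same fact with \<open>k\<close> quantified in the premise, as the
    postcondition of \<open>run_strip_ones\<close> delivers it.\<close>
  then have c: "run ?c s' ?T ?Q" if "\<exists>k. s' 2 = (Node Leaf ^^ k) Leaf
      \<and> inc_tree (s 12) = (Node Leaf ^^ k) (Node (Node Leaf Leaf) (right (s' 12)))
      \<and> tsize (s' 12) + 4 * k \<le> tsize (s 12) \<and> (\<forall>v. v \<notin> {2, 12} \<longrightarrow> s' v = s v)" for s'
    using that by blast
  have "run strip_ones (s(2 := Leaf)) (tsize (s 12) * (10 * (B + 1) + 10)) (\<lambda>s'. run ?c s' ?T ?Q)"
    by (rule run_mono[OF run_strip_ones[of _ "s 12" "B + 1"] le_refl c]) (use assms in auto)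
  moreover have "tsize (s 12) * (10 * (B + 1) + 10) \<le> B * (10 * (B + 1) + 10)"
    using assms by (rule mult_le_mono1)
  ultimately have "run strip_ones (s(2 := Leaf)) (B * (10 * (B + 1) + 10)) (\<lambda>s'. run ?c s' ?T ?Q)"
    by (rule run_mono)
  then have "run increment s (1 + 2 + (1 + B * (10 * (B + 1) + 10) + ?T)) ?Q"
    unfolding increment_def by (intro run_Seq run_Assign_le) simp_all
  then show ?thesis by (rule run_mono) (auto simp: algebra_simps)
qed

section \<open>Membership test and selection from a list\<close>

text \<open>Variable 2 tells whether variable 11 is an entry of the list in variable 10.\<close>

definition member_test :: com where
  "member_test = Seq (Assign 2 (Const Leaf)) (While (Var 10)
     (Seq (If (Equal (Fst (Var 10)) (Var 11)) (Assign 2 (Const (Node Leaf Leaf))) Skip)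
       (Assign 10 (Snd (Var 10)))))"

text \<open>Injectivity of \<open>e\<close> lets equality of trees decide equality of entries. The
  scan continues after a hit, so the invariant records membership in the part \<open>zs\<close>
  already read.\<close>

lemma run_member_test:
  assumes "inj e" "s 10 = enc_list e xs" "s 11 = e x" "tsize (s 10) \<le> B" "tsize (s 11) \<le> B"
  shows "run member_test s ((B + 1) * (20 * B + 50))
    (\<lambda>s'. s' 2 = enc_bool (x \<in> set xs) \<and> (\<forall>v. v \<notin> {2, 10} \<longrightarrow> s' v = s v))"
proof -
  define I where "I ys s' \<longleftrightarrow> (\<exists>zs. xs = zs @ ys \<and> s' 2 = enc_bool (x \<in> set zs) \<and>
    s' 10 = enc_list e ys \<and> (\<forall>v. v \<notin> {2, 10} \<longrightarrow> s' v = s v))" for ys s'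
  let ?body = "Seq (If (Equal (Fst (Var 10)) (Var 11)) (Assign 2 (Const (Node Leaf Leaf))) Skip)
       (Assign 10 (Snd (Var 10)))"
  let ?T = "10 * B + 20"
  have "run (While (Var 10) ?body) (s(2 := Leaf)) (length xs * (1 + B + ?T) + 2) (I [])"
  proof (rule run_foreach)
    fix y ys s'
    assume "I (y # ys) s'"
    then obtain zs where xs: "xs = zs @ y # ys" and s': "s' 2 = enc_bool (x \<in> set zs)"
      "s' 10 = Node (e y) (enc_list e ys)" "\<forall>v. v \<notin> {2, 10} \<longrightarrow> s' v = s v"
      by (auto simp: I_def)
    have sz: "tsize (s' 10) \<le> B"
      using assms(4) by (simp add: s' assms(2) xs tsize_enc_list)
    have guard: "eval_expr (Equal (Fst (Var 10)) (Var 11)) s' = enc_bool (y = x)"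
      using assms(1) s' by (simp add: assms(3) inj_eq)
    have post: "I ys s''" if "s'' 2 = enc_bool (x \<in> set zs \<or> y = x)" "s'' 10 = enc_list e ys"
      "\<forall>v. v \<notin> {2, 10} \<longrightarrow> s'' v = s v" for s''
      unfolding I_def by (rule exI[of _ "zs @ [y]"]) (use that in \<open>auto simp: xs\<close>)
    let ?Q = "\<lambda>s1. run (Assign 10 (Snd (Var 10))) s1 (3 * B) (I ys)"
    have "run ?body s' (1 + (1 + expr_time (Equal (Fst (Var 10)) (Var 11)) s' + 4) + 3 * B) (I ys)"
    proof (intro run_Seq run_If)
      assume "eval_expr (Equal (Fst (Var 10)) (Var 11)) s' \<noteq> Leaf"
      then have "y = x" by (metis guard enc_bool_eq_Leaf)
      then show "run (Assign 2 (Const (Node Leaf Leaf))) s' 4 ?Q"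
        by (intro run_Assign_le post) (use s' sz in auto)
    next
      assume "eval_expr (Equal (Fst (Var 10)) (Var 11)) s' = Leaf"
      then have "y \<noteq> x" by (metis guard enc_bool_eq_Leaf)
      then show "run Skip s' 4 ?Q"
        by (intro run_Skip run_Assign_le post) (use s' sz in auto)
    qed
    then have "run ?body s' ?T (I ys)"
      by (rule run_mono) (use s' sz assms(3,5) tsize_enc_bool[of "e y = e x"] in simp_all)
    then show "s' 10 \<noteq> Leaf \<and> tsize (s' 10) \<le> B \<and> run ?body s' ?T (I ys)"
      using sz by (simp add: s')
  next
    show "s' 10 = Leaf" if "I [] s'" for s' using that by (auto simp: I_def)
    show "I xs (s(2 := Leaf))"
      unfolding I_def by (rule exI[of _ "[]"]) (simp add: assms(2))
  qed
  then have "run (While (Var 10) ?body) (s(2 := Leaf)) (B * (1 + B + ?T) + 2) (I [])"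
  proof (rule run_mono)
    have "length xs * (1 + B + ?T) \<le> B * (1 + B + ?T)"
      using length_less_tsize[of xs e] assms by (intro mult_le_mono1) simp
    then show "length xs * (1 + B + ?T) + 2 \<le> B * (1 + B + ?T) + 2" by simp
  qed
  then have "run member_test s (1 + 2 + (B * (1 + B + ?T) + 2)) (I [])"
    unfolding member_test_def by (intro run_Seq run_Assign_le) simp_all
  then show ?thesis by (rule run_mono) (auto simp: I_def algebra_simps)
qed

text \<open>Producing a value is charged with its size, so a time bound is also a size
  bound.\<close>

lemma tsize_eval_expr_le: "tsize (eval_expr e s) \<le> expr_time e s"
  by (induction e) auto

text \<open>Collects the value of \<open>eO\<close> over all entries of the list in variable 4 for which the value
  of \<open>eX\<close> is an entry of the list \<open>eL\<close>; the three expressions see the current entry as the head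
  of variable 3.\<close>

definition select :: "expr \<Rightarrow> expr \<Rightarrow> expr \<Rightarrow> com" where
  "select eX eL eO = Seq (Assign 3 (Var 4)) (Seq (Assign 9 (Const Leaf)) (While (Var 3)
     (Seq (Assign 11 eX) (Seq (Assign 10 eL) (Seq member_test
       (Seq (If (Var 2) (Assign 9 (Pair eO (Var 9))) Skip) (Assign 3 (Snd (Var 3)))))))))"

definition select_time :: "nat \<Rightarrow> nat" where
  "select_time B = B * ((10 * B + 1) * (200 * B + 50) + 80 * B + 80) + 10 * B + 20"

text \<open>Filtering cannot enlarge a list, so the bound on the unfiltered output bounds every
  partial output. Variable 6 is left untouched and serves as a parameter of the expressions; entries
  are prepended, hence the \<open>rev\<close>.\<close>

lemma run_select:
  assumes s4: "s 4 = enc_list e ps" and B: "tsize (s 4) \<le> B" "tsize (enc_list eo (map h ps)) \<le> B"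
    and exprs: "\<And>p r s'. p \<in> set ps \<Longrightarrow> s' 3 = Node (e p) r \<Longrightarrow> s' 6 = s 6 \<Longrightarrow> tsize (s' 3) \<le> B \<Longrightarrow>
      eval_expr eX s' = enc_nat (x p) \<and> expr_time eX s' \<le> 10 * B \<and>
      eval_expr eL s' = enc_list enc_nat (l p) \<and> expr_time eL s' \<le> 10 * B \<and>
      eval_expr eO s' = eo (h p) \<and> expr_time eO s' \<le> 10 * B"
  shows "run (select eX eL eO) s (select_time B) (\<lambda>s'.
    s' 9 = enc_list eo (rev (map h (filter (\<lambda>p. x p \<in> set (l p)) ps))) \<and>
    (\<forall>v. v \<notin> {2, 3, 9, 10, 11} \<longrightarrow> s' v = s v))"
proof -
  define out where "out zs = enc_list eo (rev (map h (filter (\<lambda>p. x p \<in> set (l p)) zs)))" for zs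
  define I where "I ys s' \<longleftrightarrow> (\<exists>zs. ps = zs @ ys \<and> s' 9 = out zs \<and>
    s' 3 = enc_list e ys \<and> (\<forall>v. v \<notin> {2, 3, 9, 10, 11} \<longrightarrow> s' v = s v))" for ys s'
  have out_le: "tsize (out zs) \<le> B" if "ps = zs @ ys" for zs ys
  proof -
    have "tsize (out zs) \<le> Suc (\<Sum>p\<leftarrow>zs. Suc (tsize (eo (h p))))"
      by (induction zs) (auto simp: out_def tsize_enc_list)
    then show ?thesis using B(2) that by (simp add: tsize_enc_list o_def)
  qed
  let ?c5 = "Assign 3 (Snd (Var 3))"
  let ?c4 = "Seq (If (Var 2) (Assign 9 (Pair eO (Var 9))) Skip) ?c5"
  let ?c3 = "Seq member_test ?c4"
  let ?body = "Seq (Assign 11 eX) (Seq (Assign 10 eL) ?c3)"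
  \<comment> \<open>The membership test runs on the values of \<open>eX\<close> and
    \<open>eL\<close>, whose sizes are at most their cost \<open>10 * B\<close>.\<close>
  let ?M = "(10 * B + 1) * (20 * (10 * B) + 50)"
  let ?T4 = "1 + (1 + 3 + (30 * B + 5)) + (2 * B + 1)"
  let ?T = "1 + (10 * B + 1) + (1 + (10 * B + 1) + (1 + ?M + ?T4))"
  have "run (While (Var 3) ?body) (s(3 := s 4, 9 := Leaf)) (length ps * (1 + B + ?T) + 2) (I [])"
  proof (rule run_foreach)
    fix p ys s'
    assume "I (p # ys) s'"
    then obtain zs where ps: "ps = zs @ p # ys" and s': "s' 9 = out zs"
      "s' 3 = Node (e p) (enc_list e ys)" "\<forall>v. v \<notin> {2, 3, 9, 10, 11} \<longrightarrow> s' v = s v"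
      by (auto simp: I_def)
    have sz: "tsize (s' 3) \<le> B" using B(1) by (simp add: s' s4 ps tsize_enc_list)
    have ex: "eval_expr eX s'' = enc_nat (x p) \<and> expr_time eX s'' \<le> 10 * B \<and>
      eval_expr eL s'' = enc_list enc_nat (l p) \<and> expr_time eL s'' \<le> 10 * B \<and>
      eval_expr eO s'' = eo (h p) \<and> expr_time eO s'' \<le> 10 * B"
      if "s'' 3 = s' 3" "s'' 6 = s' 6" for s''
      using that s' sz by (intro exprs) (auto simp: ps)
    have out_Suc: "out (zs @ [p]) = (if x p \<in> set (l p) then Node (eo (h p)) (out zs) else out zs)"
      by (simp add: out_def)
    have post: "I ys s''" if "s'' 9 = out (zs @ [p])" "s'' 3 = enc_list e ys"
      "\<forall>v. v \<notin> {2, 3, 9, 10, 11} \<longrightarrow> s'' v = s v" for s''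
      unfolding I_def by (rule exI[of _ "zs @ [p]"]) (use that in \<open>auto simp: ps\<close>)
    have c4: "run ?c4 s2 ?T4 (I ys)"
      if s2: "s2 2 = enc_bool (x p \<in> set (l p))" "\<forall>v. v \<notin> {2, 10, 11} \<longrightarrow> s2 v = s' v" for s2
    proof -
      have "s2 3 = s' 3" "s2 6 = s' 6" using s2(2) by auto
      note ex2 = ex[OF this]
      have t2: "expr_time (Var 2) s2 \<le> 3" using s2(1) tsize_enc_bool by simp
      have s2': "s2 9 = out zs" "s2 3 = Node (e p) (enc_list e ys)" "tsize (s2 3) \<le> B"
        "\<forall>v. v \<notin> {2, 3, 9, 10, 11} \<longrightarrow> s2 v = s v"
        using s2(2) s' sz by auto
      let ?Q = "\<lambda>s3. run ?c5 s3 (2 * B + 1) (I ys)"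
      have "run ?c4 s2 (1 + (1 + expr_time (Var 2) s2 + (30 * B + 5)) + (2 * B + 1)) (I ys)"
      proof (intro run_Seq run_If)
        assume "eval_expr (Var 2) s2 \<noteq> Leaf"
        then have "x p \<in> set (l p)" using s2(1) by (simp add: enc_bool_eq_Leaf)
        then show "run (Assign 9 (Pair eO (Var 9))) s2 (30 * B + 5) ?Q"
          using ex2 s2' tsize_eval_expr_le[of eO s2] out_le[OF ps]
          by (intro run_Assign_le post) (auto simp: out_Suc)
      next
        assume "eval_expr (Var 2) s2 = Leaf"
        then have "x p \<notin> set (l p)" using s2(1) by (simp add: enc_bool_eq_Leaf)
        then show "run Skip s2 (30 * B + 5) ?Q"
          using s2' by (intro run_Skip run_Assign_le post) (auto simp: out_Suc)
      qed
      then show ?thesis by (rule run_mono) (use t2 in auto)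
    qed
    let ?s2 = "s'(11 := enc_nat (x p), 10 := enc_list enc_nat (l p))"
    have sz2: "tsize (enc_nat (x p)) \<le> 10 * B" "tsize (enc_list enc_nat (l p)) \<le> 10 * B"
      using ex[of s'] tsize_eval_expr_le[of eX s'] tsize_eval_expr_le[of eL s'] by auto
    have "run member_test ?s2 ?M (\<lambda>s2. run ?c4 s2 ?T4 (I ys))"
      by (rule run_mono[OF run_member_test[OF inj_enc_nat, of ?s2 "l p" "x p" "10 * B"] le_refl c4])
        (use sz2 in auto)
    then have "run ?body s' ?T (I ys)"
      using ex[of s'] ex[of "s'(11 := enc_nat (x p))"] by (intro run_Seq run_Assign_le) simp_all
    then show "s' 3 \<noteq> Leaf \<and> tsize (s' 3) \<le> B \<and> run ?body s' ?T (I ys)"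
      using sz by (simp add: s')
  next
    show "s' 3 = Leaf" if "I [] s'" for s' using that by (auto simp: I_def)
    show "I ps (s(3 := s 4, 9 := Leaf))"
      unfolding I_def by (rule exI[of _ "[]"]) (simp add: s4 out_def)
  qed
  then have "run (While (Var 3) ?body) (s(3 := s 4, 9 := Leaf)) (B * (1 + B + ?T) + 2) (I [])"
  proof (rule run_mono)
    have "length ps * (1 + B + ?T) \<le> B * (1 + B + ?T)"
      using length_less_tsize[of ps e] B s4 by (intro mult_le_mono1) simp
    then show "length ps * (1 + B + ?T) + 2 \<le> B * (1 + B + ?T) + 2" by simp
  qed
  then have "run (select eX eL eO) s (1 + (B + 1) + (1 + 3 + (B * (1 + B + ?T) + 2))) (I [])"
    unfolding select_def using B by (intro run_Seq run_Assign_le) simp_all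
  then show ?thesis
    by (rule run_mono) (auto simp: I_def out_def select_time_def algebra_simps)
qed

section \<open>Intervals and indexed sets, with their sizes\<close>

abbreviation enc_sets :: "nat list list \<Rightarrow> tree" where
  "enc_sets \<equiv> enc_list (enc_list enc_nat)"

abbreviation enc_indexed :: "(nat \<times> nat list) list \<Rightarrow> tree" where
  "enc_indexed \<equiv> enc_list (enc_prod enc_nat (enc_list enc_nat))"

abbreviation enc_interval :: "rat \<times> rat \<times> rat \<Rightarrow> tree" where
  "enc_interval \<equiv> enc_prod enc_rat (enc_prod enc_rat enc_rat)"

definition set_interval :: "rat \<times> rat \<times> rat" where
  "set_interval = (0, 2, 1)"

definition unit_interval :: "rat \<times> rat \<times> rat" where
  "unit_interval = (1, 1, 1)"

text \<open>The unit interval comes last, at index \<open>Suc m\<close>, so that the program can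
  prepend one set interval per set.\<close>

definition intervals :: "nat \<Rightarrow> (rat \<times> rat \<times> rat) list" where
  "intervals m = replicate m set_interval @ [unit_interval]"

text \<open>Decreasing indices, because the program prepends while counting upwards; the reversal in
  \<open>select\<close> restores the order.\<close>

definition indexed :: "nat list list \<Rightarrow> (nat \<times> nat list) list" where
  "indexed ss = rev (zip [1..<Suc (length ss)] ss)"

lemma indexed_snoc: "indexed (zs @ [S]) = (Suc (length zs), S) # indexed zs"
  by (simp add: indexed_def upt_Suc_append[of "Suc 0" "Suc (length zs)"] del: upt_Suc)

lemma intervals_Suc: "intervals (Suc m) = set_interval # intervals m"
  by (simp add: intervals_def)

lemma mem_indexed: "p \<in> set (indexed ss) \<Longrightarrow>
    fst p \<in> {1..length ss} \<and> snd p \<in> set ss \<and> snd p = ss ! (fst p - 1)"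
  by (auto simp: indexed_def set_zip simp del: upt_Suc)

text \<open>A sum, rather than a maximum, of the bounds for the input and single indices, the
  indexed sets, the intervals, one row, and all rows; this keeps it a polynomial.\<close>

definition size_bound :: "nat \<Rightarrow> nat" where
  "size_bound N = 10 * N + 20 + (N * (5 * N + 3) + 1) +
     (N * (tsize (enc_interval set_interval) + tsize (enc_interval unit_interval) + 1) + 1) +
     (N * (4 * N + 2) + 1) + (N * (N * (4 * N + 2) + 1 + (4 * N + 3) + 1) + 1)"

text \<open>Stated for prefixes \<open>zs\<close>, since the loop holds the sets read so far. A pair
  takes \<open>4 * N + 1\<close> for the index, \<open>N\<close> for the set and 1 for the
  node.\<close>

lemma tsize_indexed_le:
  assumes "ss = zs @ ys" "tsize (enc_sets ss) \<le> N"
  shows "tsize (enc_indexed (indexed zs)) \<le> size_bound N"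
proof -
  have len: "length ss < N" using length_less_tsize[of ss] assms(2) by (rule less_le_trans)
  have "tsize (enc_indexed (indexed zs)) \<le> N * ((5 * N + 2) + 1) + 1"
  proof (rule tsize_enc_list_le)
    fix p assume "p \<in> set (indexed zs)"
    from mem_indexed[OF this] have p: "fst p \<le> length zs" "snd p \<in> set ss" using assms by auto
    have "tsize (enc_nat (fst p)) \<le> 4 * N + 1"
      using tsize_enc_nat[of "fst p"] p(1) len assms(1) by simp
    moreover have "tsize (enc_list enc_nat (snd p)) \<le> N"
      using tsize_member_le[OF p(2)] assms(2) by (rule le_trans)
    ultimately show "tsize (enc_prod enc_nat (enc_list enc_nat) p) \<le> 5 * N + 2"
      by (cases p) (simp add: enc_prod_def)
  next
    show "length (indexed zs) \<le> N" using len assms(1) by (simp add: indexed_def)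
  qed
  then show ?thesis by (simp add: size_bound_def algebra_simps)
qed

lemma tsize_intervals_le:
  assumes "m < N"
  shows "tsize (enc_list enc_interval (intervals m)) \<le> size_bound N"
proof -
  have "tsize (enc_list enc_interval (intervals m)) \<le>
      N * ((tsize (enc_interval set_interval) + tsize (enc_interval unit_interval)) + 1) + 1"
    by (rule tsize_enc_list_le) (use assms in \<open>auto simp: intervals_def\<close>)
  then show ?thesis by (simp add: size_bound_def algebra_simps)
qed

text \<open>From the list of sets in variable 3, variable 4 gets the indexed sets, variable 5 the
  intervals and variable 12 the index of the unit interval.\<close>

definition index_sets :: com where
  "index_sets = Seq (Assign 12 (Const (enc_nat 1))) (Seq (Assign 4 (Const Leaf))
    (Seq (Assign 5 (Const (Node (enc_interval unit_interval) Leaf))) (While (Var 3)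
      (Seq (Assign 4 (Pair (Pair (Var 12) (Fst (Var 3))) (Var 4)))
      (Seq (Assign 5 (Pair (Const (enc_interval set_interval)) (Var 5)))
      (Seq increment (Assign 3 (Snd (Var 3)))))))))"

definition index_time :: "nat \<Rightarrow> nat" where
  "index_time B = B * ((B + 5) * (20 * B + 200) + 40 * B + 50) + 10 * B + 50"

text \<open>Variable 12 always holds the index of the next set, which at the end is the index of the
  unit interval. Variable 0 is preserved because the input is read again later.\<close>

lemma run_index_sets:
  assumes s3: "s 3 = enc_sets ss" and N: "tsize (s 3) \<le> N"
  shows "run index_sets s (index_time (size_bound N)) (\<lambda>s'. s' 4 = enc_indexed (indexed ss) \<and>
    s' 5 = enc_list enc_interval (intervals (length ss)) \<and> s' 12 = enc_nat (Suc (length ss)) \<and>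
    s' 0 = s 0)"
proof -
  define B where "B = size_bound N"
  define I where "I ys s' \<longleftrightarrow> (\<exists>zs. ss = zs @ ys \<and> s' 3 = enc_sets ys \<and>
    s' 4 = enc_indexed (indexed zs) \<and> s' 5 = enc_list enc_interval (intervals (length zs)) \<and>
    s' 12 = enc_nat (Suc (length zs)) \<and> s' 0 = s 0)" for ys and s' :: store
  have len: "length ss < N" using length_less_tsize[of ss] N s3 by (metis less_le_trans)
  have NB: "4 * N + 20 \<le> B" unfolding B_def size_bound_def by simp
  let ?body = "Seq (Assign 4 (Pair (Pair (Var 12) (Fst (Var 3))) (Var 4)))
      (Seq (Assign 5 (Pair (Const (enc_interval set_interval)) (Var 5)))
      (Seq increment (Assign 3 (Snd (Var 3)))))"
  let ?M = "(B + 5) * (20 * B + 200)"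
  let ?T = "1 + (20 * B + 10) + (1 + (10 * B + 10) + (1 + ?M + (2 * B + 1)))"
  let ?s0 = "s(12 := enc_nat 1, 4 := Leaf, 5 := Node (enc_interval unit_interval) Leaf)"
  have "run (While (Var 3) ?body) ?s0 (length ss * (1 + B + ?T) + 2) (I [])"
  proof (rule run_foreach)
    fix S ys s'
    assume "I (S # ys) s'"
    then obtain zs where ss: "ss = zs @ S # ys" and s': "s' 3 = Node (enc_list enc_nat S) (enc_sets ys)"
      "s' 4 = enc_indexed (indexed zs)" "s' 5 = enc_list enc_interval (intervals (length zs))"
      "s' 12 = enc_nat (Suc (length zs))" "s' 0 = s 0"
      by (auto simp: I_def)
    have sz3: "tsize (s' 3) \<le> B" using N NB by (simp add: s3 s' ss tsize_enc_list)
    have sz4: "tsize (s' 4) \<le> B" "tsize (enc_indexed (indexed (zs @ [S]))) \<le> B"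
      using tsize_indexed_le[of ss zs "S # ys" N] tsize_indexed_le[of ss "zs @ [S]" ys N] N
      by (auto simp: s' B_def ss s3)
    have sz5: "tsize (s' 5) \<le> B" "tsize (enc_list enc_interval (intervals (Suc (length zs)))) \<le> B"
      using tsize_intervals_le[of "length zs" N] tsize_intervals_le[of "Suc (length zs)" N] len
      by (auto simp: s' B_def ss)
    have sz12: "tsize (s' 12) \<le> B"
      using tsize_enc_nat[of "Suc (length zs)"] len NB by (simp add: s' ss)
    have post: "I ys s''" if "s'' 3 = enc_sets ys" "s'' 4 = enc_indexed (indexed (zs @ [S]))"
      "s'' 5 = enc_list enc_interval (intervals (Suc (length zs)))"
      "s'' 12 = enc_nat (Suc (Suc (length zs)))" "s'' 0 = s 0" for s''
      unfolding I_def by (rule exI[of _ "zs @ [S]"]) (use that in \<open>auto simp: ss\<close>)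
    let ?s2 = "s'(4 := enc_indexed (indexed (zs @ [S])),
      5 := enc_list enc_interval (intervals (Suc (length zs))))"
    have "run increment ?s2 ?M (\<lambda>s2. run (Assign 3 (Snd (Var 3))) s2 (2 * B + 1) (I ys))"
    proof (rule run_mono[OF run_increment[of ?s2 B] le_refl])
      fix s2 assume "s2 12 = inc_tree (?s2 12) \<and> (\<forall>v. v \<notin> {2, 12} \<longrightarrow> s2 v = ?s2 v)"
      then show "run (Assign 3 (Snd (Var 3))) s2 (2 * B + 1) (I ys)"
        using sz3 s' by (intro run_Assign_le post) (auto simp: inc_tree_enc_nat)
    qed (use sz12 in simp)
    then have "run ?body s' ?T (I ys)"
      using s' sz3 sz4 sz5 sz12
      by (intro run_Seq run_Assign_le) (simp_all add: indexed_snoc intervals_Suc enc_prod_def)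
    then show "s' 3 \<noteq> Leaf \<and> tsize (s' 3) \<le> B \<and> run ?body s' ?T (I ys)"
      using sz3 by (simp add: s')
  next
    show "s' 3 = Leaf" if "I [] s'" for s' using that by (auto simp: I_def)
    show "I ss ?s0"
      unfolding I_def by (rule exI[of _ "[]"]) (simp add: s3 indexed_def intervals_def)
  qed
  then have "run (While (Var 3) ?body) ?s0 (B * (1 + B + ?T) + 2) (I [])"
  proof (rule run_mono)
    have "length ss * (1 + B + ?T) \<le> B * (1 + B + ?T)"
      using len NB by (intro mult_le_mono1) simp
    then show "length ss * (1 + B + ?T) + 2 \<le> B * (1 + B + ?T) + 2" by simp
  qed
  moreover have "tsize (Node (enc_interval unit_interval) Leaf) \<le> B"
    using tsize_intervals_le[of 0 N] len by (simp add: intervals_def B_def)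
  moreover have "tsize (enc_nat 1) \<le> 5" using tsize_enc_nat[of 1] by simp
  ultimately have "run index_sets s (1 + 6 + (1 + 2 + (1 + (B + 1) + (B * (1 + B + ?T) + 2)))) (I [])"
    unfolding index_sets_def by (intro run_Seq run_Assign_le) simp_all
  then show ?thesis
    by (rule run_mono) (auto simp: I_def index_time_def B_def[symmetric] algebra_simps)
qed


section \<open>The two maps of the reduction\<close>

text \<open>The set \<open>S_i\<close> as a list, in the form in which \<open>select\<close> returns
  it.\<close>

definition row :: "nat list list \<Rightarrow> nat \<Rightarrow> nat list" where
  "row ss i = rev (map fst (filter (\<lambda>p. i \<in> set (snd p)) (indexed ss)))"

text \<open>The program starts from the singleton of the unit interval and prepends the rows, hence
  the reversal.\<close>

definition rows :: "nat list list \<Rightarrow> nat list \<Rightarrow> nat list list" where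
  "rows ss us = rev (map (row ss) us) @ [[Suc (length ss)]]"

text \<open>Turns a query set back into sets; the index of the unit interval, if queried, belongs to
  no pair and is dropped.\<close>

definition chosen :: "nat list list \<Rightarrow> nat list \<Rightarrow> nat list list" where
  "chosen ss qs = rev (map snd (filter (\<lambda>p. fst p \<in> set qs) (indexed ss)))"

text \<open>An element in no set would give an empty row of weight 0, and then already the empty query
  set would be feasible. Only an empty family makes the MinSet instance infeasible.\<close>

definition to_minset :: "nat \<times> nat list list \<Rightarrow> minset_instance" where
  "to_minset = (\<lambda>(n, ss). (intervals (length ss),
     if \<exists>i\<in>{1..n}. row ss i = [] then [] else rows ss [1..<Suc n]))"

text \<open>Variable 6 holds the remaining elements with the current one as head, variable 7 the
  rows so far, and variable 8 a flag that is raised by an empty row.\<close>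

definition to_minset_body :: com where
  "to_minset_body = Seq (select (Fst (Var 6)) (Snd (Fst (Var 3))) (Fst (Fst (Var 3))))
     (Seq (If (Var 9) Skip (Assign 8 (Const (Node Leaf Leaf))))
     (Seq (Assign 7 (Pair (Var 9) (Var 7))) (Assign 6 (Snd (Var 6)))))"

text \<open>While variable 7 is \<open>Leaf\<close>, the nested pair encodes the list whose only
  entry is the singleton of the unit interval.\<close>

definition to_minset_program :: com where
  "to_minset_program = Seq (Assign 3 (Snd (Var 0))) (Seq index_sets (Seq (Assign 6 (Fst (Var 0)))
     (Seq (Assign 7 (Const Leaf)) (Seq (Assign 7 (Pair (Pair (Var 12) (Var 7)) (Var 7)))
     (Seq (Assign 8 (Const Leaf)) (Seq (While (Var 6) to_minset_body)
     (Seq (If (Var 8) (Assign 7 (Const Leaf)) Skip) (Assign 0 (Pair (Var 5) (Var 7))))))))))"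

text \<open>Here \<open>select\<close> looks up the index of each pair in the query list, kept in
  variable 6, and collects the set.\<close>

definition chosen_program :: com where
  "chosen_program = Seq (Assign 3 (Snd (Fst (Var 0)))) (Seq index_sets (Seq (Assign 6 (Snd (Var 0)))
     (Seq (select (Fst (Fst (Var 3))) (Var 6) (Snd (Fst (Var 3)))) (Assign 0 (Var 9)))))"

section \<open>Sizes of the outputs and running times of the two programs\<close>

lemma tsize_indices_le:
  assumes "tsize (enc_sets ss) \<le> N"
  shows "tsize (enc_list enc_nat (map fst (indexed ss))) \<le> N * (4 * N + 2) + 1"
proof -
  have len: "length ss < N" using length_less_tsize[of ss] assms by (rule less_le_trans)
  have "tsize (enc_list enc_nat (map fst (indexed ss))) \<le> N * ((4 * N + 1) + 1) + 1"
  proof (rule tsize_enc_list_le)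
    fix j assume "j \<in> set (map fst (indexed ss))"
    then have "j \<le> length ss" using mem_indexed by fastforce
    then show "tsize (enc_nat j) \<le> 4 * N + 1" using tsize_enc_nat[of j] len by simp
  next
    show "length (map fst (indexed ss)) \<le> N" using len by (simp add: indexed_def)
  qed
  then show ?thesis by simp
qed

lemma tsize_row_le:
  assumes "tsize (enc_sets ss) \<le> N"
  shows "tsize (enc_list enc_nat (row ss i)) \<le> N * (4 * N + 2) + 1"
proof -
  have "tsize (enc_list enc_nat (rev (map fst (filter P ps)))) \<le> tsize (enc_list enc_nat (map fst ps))"
    for P :: "nat \<times> nat list \<Rightarrow> bool" and ps
    by (induction ps) (auto simp: tsize_enc_list)
  then show ?thesis unfolding row_def using tsize_indices_le[OF assms] by (rule le_trans)
qed

text \<open>The strict inequality for \<open>us\<close> leaves room for the singleton, of size at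
  most \<open>4 * N + 3\<close>; adding this to the bound for a row covers both kinds of
  entries.\<close>

lemma tsize_rows_le:
  assumes "tsize (enc_sets ss) \<le> N" "length us < N"
  shows "tsize (enc_sets (rows ss us)) \<le> size_bound N"
proof -
  have len: "length ss < N" using length_less_tsize[of ss] assms(1) by (rule less_le_trans)
  have "tsize (enc_sets (rows ss us)) \<le> N * ((N * (4 * N + 2) + 1 + (4 * N + 3)) + 1) + 1"
  proof (rule tsize_enc_list_le)
    fix r assume "r \<in> set (rows ss us)"
    then consider i where "r = row ss i" | "r = [Suc (length ss)]" by (auto simp: rows_def)
    then show "tsize (enc_list enc_nat r) \<le> N * (4 * N + 2) + 1 + (4 * N + 3)"
    proof cases
      case (1 i)
      then show ?thesis using tsize_row_le[OF assms(1), of i] by simp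
    next
      case 2
      then show ?thesis using tsize_enc_nat[of "Suc (length ss)"] len by simp
    qed
  next
    show "length (rows ss us) \<le> N" using assms(2) by (simp add: rows_def)
  qed
  then show ?thesis by (simp add: size_bound_def)
qed

definition to_minset_time :: "nat \<Rightarrow> nat" where
  "to_minset_time B = index_time B + B * (select_time B + 20 * B + 50) + 100 * B + 100"

text \<open>All rows are computed in any case. The flag remembers whether one of them was empty, and
  if so the family is replaced by the empty one at the end.\<close>

lemma run_to_minset_program:
  assumes s0: "s 0 = Node (enc_list enc_nat us) (enc_sets ss)" and N: "tsize (s 0) \<le> N"
  shows "run to_minset_program s (to_minset_time (size_bound N)) (\<lambda>s'. s' 0 =
    Node (enc_list enc_interval (intervals (length ss)))
      (enc_sets (if \<exists>i\<in>set us. row ss i = [] then [] else rows ss us)))"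
proof -
  define B where "B = size_bound N"
  have sets: "tsize (enc_sets ss) \<le> N" and "tsize (enc_list enc_nat us) \<le> N" using N s0 by auto
  have lens: "length ss < N" using length_less_tsize[of ss] sets by (rule less_le_trans)
  have lenu: "length us < N" using length_less_tsize[of us] \<open>tsize (enc_list enc_nat us) \<le> N\<close> by (rule less_le_trans)
  have NB: "10 * N + 20 \<le> B" unfolding B_def size_bound_def by simp
  have rB: "tsize (enc_list enc_nat (row ss i)) \<le> B" for i
    using tsize_row_le[OF sets, of i] by (simp add: B_def size_bound_def)
  have RB: "tsize (enc_sets (rows ss zs)) \<le> B" if "us = zs @ ys" for zs ys
    unfolding B_def using lenu that by (intro tsize_rows_le sets) simp
  have XB: "tsize (enc_indexed (indexed ss)) \<le> B"
    using tsize_indexed_le[of ss ss "[]" N] sets by (simp add: B_def)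
  have iB: "tsize (enc_list enc_nat (map fst (indexed ss))) \<le> B"
    using tsize_indices_le[OF sets] by (simp add: B_def size_bound_def)
  have IB: "tsize (enc_list enc_interval (intervals (length ss))) \<le> B"
    unfolding B_def by (rule tsize_intervals_le[OF lens])
  define I where "I ys s' \<longleftrightarrow> (\<exists>zs. us = zs @ ys \<and> s' 6 = enc_list enc_nat ys \<and>
    s' 7 = enc_sets (rows ss zs) \<and> s' 8 = enc_bool (\<exists>i\<in>set zs. row ss i = []) \<and>
    s' 4 = enc_indexed (indexed ss) \<and> s' 5 = enc_list enc_interval (intervals (length ss)))"
    for ys and s' :: store
  let ?Q = "\<lambda>s'. s' 0 = Node (enc_list enc_interval (intervals (length ss)))
      (enc_sets (if \<exists>i\<in>set us. row ss i = [] then [] else rows ss us))"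
  let ?T3 = "1 + (5 * B + 5) + (3 * B + 1)"
  let ?T = "1 + select_time B + (1 + (1 + B + 5) + ?T3)"
  let ?L = "B * (1 + B + ?T) + 2"
  have loop: "run (While (Var 6) to_minset_body) s1 ?L (I [])" if "I us s1" for s1
  proof -
    have "run (While (Var 6) to_minset_body) s1 (length us * (1 + B + ?T) + 2) (I [])"
    proof (rule run_foreach)
      fix i ys s'
      assume "I (i # ys) s'"
      then obtain zs where us: "us = zs @ i # ys" and s': "s' 6 = Node (enc_nat i) (enc_list enc_nat ys)"
        "s' 7 = enc_sets (rows ss zs)" "s' 8 = enc_bool (\<exists>i\<in>set zs. row ss i = [])"
        "s' 4 = enc_indexed (indexed ss)" "s' 5 = enc_list enc_interval (intervals (length ss))"
        by (auto simp: I_def)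
      have "tsize (s' 6) \<le> tsize (enc_list enc_nat us)" by (simp add: s' us tsize_enc_list)
      then have sz6: "tsize (s' 6) \<le> B" using \<open>tsize (enc_list enc_nat us) \<le> N\<close> NB by linarith
      have sz7: "tsize (enc_sets (rows ss zs)) \<le> B" "tsize (enc_sets (rows ss (zs @ [i]))) \<le> B"
        using RB[of zs "i # ys"] RB[of "zs @ [i]" ys] us by auto
      have post: "I ys s''" if "s'' 6 = enc_list enc_nat ys" "s'' 7 = enc_sets (rows ss (zs @ [i]))"
        "s'' 8 = enc_bool (row ss i = [] \<or> (\<exists>i\<in>set zs. row ss i = []))"
        "s'' 4 = s' 4" "s'' 5 = s' 5" for s''
        unfolding I_def by (rule exI[of _ "zs @ [i]"]) (use that s' in \<open>auto simp: us\<close>)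
      have rows: "enc_sets (rows ss (zs @ [i])) = Node (enc_list enc_nat (row ss i)) (enc_sets (rows ss zs))"
        by (simp add: rows_def)
      let ?c3 = "Seq (Assign 7 (Pair (Var 9) (Var 7))) (Assign 6 (Snd (Var 6)))"
      let ?c2 = "Seq (If (Var 9) Skip (Assign 8 (Const (Node Leaf Leaf)))) ?c3"
      have c2: "run ?c2 s2 (1 + (1 + B + 5) + ?T3) (I ys)"
        if s2: "s2 9 = enc_list enc_nat (row ss i) \<and> (\<forall>v. v \<notin> {2, 3, 9, 10, 11} \<longrightarrow> s2 v = s' v)" for s2
      proof -
        have c3: "run ?c3 s3 ?T3 (I ys)" if "s3 9 = enc_list enc_nat (row ss i)" "s3 7 = s' 7" "s3 6 = s' 6"
          "s3 8 = enc_bool (row ss i = [] \<or> (\<exists>i\<in>set zs. row ss i = []))"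
          "s3 4 = s' 4" "s3 5 = s' 5" for s3
          using that s' sz6 sz7 rB[of i]
          by (intro run_Seq run_Assign_le post) (simp_all add: rows)
        have "run ?c2 s2 (1 + (1 + expr_time (Var 9) s2 + 5) + ?T3) (I ys)"
        proof (intro run_Seq run_If)
          assume "eval_expr (Var 9) s2 \<noteq> Leaf"
          then have "row ss i \<noteq> []" using s2 by (simp add: enc_list_eq_Leaf)
          then show "run Skip s2 5 (\<lambda>s3. run ?c3 s3 ?T3 (I ys))"
            using s2 s' by (intro run_Skip c3) auto
        next
          assume "eval_expr (Var 9) s2 = Leaf"
          then have "row ss i = []" using s2 by (simp add: enc_list_eq_Leaf)
          then show "run (Assign 8 (Const (Node Leaf Leaf))) s2 5 (\<lambda>s3. run ?c3 s3 ?T3 (I ys))"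
            using s2 s' by (intro run_Assign_le c3) auto
        qed
        then show ?thesis by (rule run_mono) (use s2 rB[of i] in auto)
      qed
      \<comment> \<open>The current element \<open>i\<close> is tested against every set, and the
        indices of the hits are collected.\<close>
      have "run (select (Fst (Var 6)) (Snd (Fst (Var 3))) (Fst (Fst (Var 3)))) s' (select_time B)
        (\<lambda>s2. s2 9 = enc_list enc_nat (row ss i) \<and> (\<forall>v. v \<notin> {2, 3, 9, 10, 11} \<longrightarrow> s2 v = s' v))"
        unfolding row_def
      proof (rule run_select)
        show "s' 4 = enc_indexed (indexed ss)" by fact
        show "tsize (s' 4) \<le> B" using XB by (simp add: s')
        show "tsize (enc_list enc_nat (map fst (indexed ss))) \<le> B" by fact
      qed (use sz6 in \<open>auto simp: s' enc_prod_def\<close>)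
      then have "run to_minset_body s' ?T (I ys)"
        unfolding to_minset_body_def by (intro run_Seq) (rule run_mono[OF _ le_refl c2])
      then show "s' 6 \<noteq> Leaf \<and> tsize (s' 6) \<le> B \<and> run to_minset_body s' ?T (I ys)"
        using sz6 by (simp add: s')
    next
      show "s' 6 = Leaf" if "I [] s'" for s' using that by (auto simp: I_def)
      show "I us s1" by fact
    qed
    then show ?thesis
    proof (rule run_mono)
      have "length us * (1 + B + ?T) \<le> B * (1 + B + ?T)" using lenu NB by (intro mult_le_mono1) simp
      then show "length us * (1 + B + ?T) + 2 \<le> ?L" by simp
    qed
  qed
  let ?c3 = "Seq (If (Var 8) (Assign 7 (Const Leaf)) Skip) (Assign 0 (Pair (Var 5) (Var 7)))"
  let ?U3 = "1 + (1 + 3 + 5) + (5 * B + 5)"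
  have c3: "run ?c3 s1 ?U3 ?Q" if "I [] s1" for s1
  proof -
    have s1: "s1 7 = enc_sets (rows ss us)" "s1 8 = enc_bool (\<exists>i\<in>set us. row ss i = [])"
      "s1 5 = enc_list enc_interval (intervals (length ss))" using that by (auto simp: I_def)
    have "run ?c3 s1 (1 + (1 + expr_time (Var 8) s1 + 5) + (5 * B + 5)) ?Q"
    proof (intro run_Seq run_If)
      assume "eval_expr (Var 8) s1 \<noteq> Leaf"
      then have "\<exists>i\<in>set us. row ss i = []" using s1 by (simp add: enc_bool_eq_Leaf)
      then show "run (Assign 7 (Const Leaf)) s1 5 (\<lambda>s2. run (Assign 0 (Pair (Var 5) (Var 7))) s2 (5 * B + 5) ?Q)"
        using s1 IB NB by (intro run_Assign_le) simp_all
    next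
      assume "eval_expr (Var 8) s1 = Leaf"
      then have "\<not> (\<exists>i\<in>set us. row ss i = [])" using s1 by (simp add: enc_bool_eq_Leaf)
      then show "run Skip s1 5 (\<lambda>s2. run (Assign 0 (Pair (Var 5) (Var 7))) s2 (5 * B + 5) ?Q)"
        using s1 IB RB[of us "[]"] by (intro run_Skip run_Assign_le) auto
    qed
    then show ?thesis by (rule run_mono) (use s1 tsize_enc_bool in auto)
  qed
  let ?c2 = "Seq (Assign 6 (Fst (Var 0)))
     (Seq (Assign 7 (Const Leaf)) (Seq (Assign 7 (Pair (Pair (Var 12) (Var 7)) (Var 7)))
     (Seq (Assign 8 (Const Leaf)) (Seq (While (Var 6) to_minset_body) ?c3))))"
  let ?U2 = "1 + (2 * B + 1) + (1 + 2 + (1 + (5 * B + 10) + (1 + 2 + (1 + ?L + ?U3))))"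
  have c2: "run ?c2 s1 ?U2 ?Q" if s1: "s1 4 = enc_indexed (indexed ss) \<and>
    s1 5 = enc_list enc_interval (intervals (length ss)) \<and> s1 12 = enc_nat (Suc (length ss)) \<and>
    s1 0 = s 0" for s1
  proof -
    let ?s2 = "s1(6 := enc_list enc_nat us, 7 := enc_sets [[Suc (length ss)]], 8 := Leaf)"
    have "I us ?s2" unfolding I_def by (rule exI[of _ "[]"]) (use s1 in \<open>simp add: rows_def\<close>)
    from run_mono[OF loop[OF this] le_refl c3]
    have "run (While (Var 6) to_minset_body) ?s2 ?L (\<lambda>s3. run ?c3 s3 ?U3 ?Q)" .
    moreover have "tsize (enc_nat (Suc (length ss))) \<le> B"
      using tsize_enc_nat[of "Suc (length ss)"] lens NB by simp
    ultimately show ?thesis using s1 s0 N NB by (intro run_Seq run_Assign_le) simp_all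
  qed
  have "run index_sets (s(3 := enc_sets ss)) (index_time B) (\<lambda>s1. run ?c2 s1 ?U2 ?Q)"
    by (rule run_mono[OF run_index_sets[of _ ss N] _ c2]) (use sets B_def in auto)
  then have "run to_minset_program s (1 + (2 * B + 1) + (1 + index_time B + ?U2)) ?Q"
    unfolding to_minset_program_def using s0 N NB by (intro run_Seq run_Assign_le) simp_all
  then show ?thesis
    by (rule run_mono) (auto simp: to_minset_time_def B_def[symmetric] algebra_simps)
qed

definition chosen_time :: "nat \<Rightarrow> nat" where
  "chosen_time B = index_time B + select_time B + 20 * B + 100"

lemma run_chosen_program:
  assumes s0: "s 0 = Node (Node E (enc_sets ss)) (enc_list enc_nat qs)" and N: "tsize (s 0) \<le> N"
  shows "run chosen_program s (chosen_time (size_bound N)) (\<lambda>s'. s' 0 = enc_sets (chosen ss qs))"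
proof -
  define B where "B = size_bound N"
  have sets: "tsize (enc_sets ss) \<le> N" and qs: "tsize (enc_list enc_nat qs) \<le> N" using N s0 by auto
  have NB: "10 * N + 20 \<le> B" unfolding B_def size_bound_def by simp
  have XB: "tsize (enc_indexed (indexed ss)) \<le> B"
    using tsize_indexed_le[of ss ss "[]" N] sets by (simp add: B_def)
  \<comment> \<open>Unfiltered, the output is the given family in reverse order, so it has the same
    size.\<close>
  have "map snd (indexed ss) = rev ss"
    by (simp add: indexed_def rev_map[symmetric] map_snd_zip del: upt_Suc)
  then have SB: "tsize (enc_sets (map snd (indexed ss))) \<le> N"
    using sets by (simp add: tsize_enc_list rev_map[symmetric])
  have CB: "tsize (enc_sets (chosen ss qs)) \<le> B"
  proof -
    have "tsize (enc_sets (rev (map snd (filter P ps)))) \<le> tsize (enc_sets (map snd ps))"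
      for P :: "nat \<times> nat list \<Rightarrow> bool" and ps
      by (induction ps) (auto simp: tsize_enc_list)
    then have "tsize (enc_sets (chosen ss qs)) \<le> N" unfolding chosen_def using SB by (rule le_trans)
    then show ?thesis using NB by linarith
  qed
  let ?Q = "\<lambda>s'. s' 0 = enc_sets (chosen ss qs)"
  let ?c2 = "Seq (Assign 6 (Snd (Var 0)))
     (Seq (select (Fst (Fst (Var 3))) (Var 6) (Snd (Fst (Var 3)))) (Assign 0 (Var 9)))"
  let ?T2 = "1 + (2 * B + 1) + (1 + select_time B + (B + 1))"
  have c2: "run ?c2 s1 ?T2 ?Q" if s1: "s1 4 = enc_indexed (indexed ss) \<and>
    s1 5 = enc_list enc_interval (intervals (length ss)) \<and> s1 12 = enc_nat (Suc (length ss)) \<and>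
    s1 0 = s 0" for s1
  proof -
    let ?s2 = "s1(6 := enc_list enc_nat qs)"
    have "run (select (Fst (Fst (Var 3))) (Var 6) (Snd (Fst (Var 3)))) ?s2 (select_time B)
        (\<lambda>s3. s3 9 = enc_sets (chosen ss qs) \<and> (\<forall>v. v \<notin> {2, 3, 9, 10, 11} \<longrightarrow> s3 v = ?s2 v))"
      unfolding chosen_def
    proof (rule run_select)
      show "?s2 4 = enc_indexed (indexed ss)" using s1 by simp
      show "tsize (?s2 4) \<le> B" using XB s1 by simp
      show "tsize (enc_sets (map snd (indexed ss))) \<le> B" using SB NB by linarith
    qed (use qs NB in \<open>auto simp: enc_prod_def\<close>)
    then have "run (select (Fst (Fst (Var 3))) (Var 6) (Snd (Fst (Var 3)))) ?s2 (select_time B)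
        (\<lambda>s3. run (Assign 0 (Var 9)) s3 (B + 1) ?Q)"
      by (rule run_mono[OF _ le_refl], intro run_Assign_le) (use CB in auto)
    then show ?thesis using s1 s0 N NB by (intro run_Seq run_Assign_le) simp_all
  qed
  have "run index_sets (s(3 := enc_sets ss)) (index_time B) (\<lambda>s1. run ?c2 s1 ?T2 ?Q)"
    by (rule run_mono[OF run_index_sets[of _ ss N] _ c2]) (use sets B_def in auto)
  then have "run chosen_program s (1 + (4 * B + 1) + (1 + index_time B + ?T2)) ?Q"
    unfolding chosen_program_def using s0 N NB by (intro run_Seq run_Assign_le) simp_all
  then show ?thesis
    by (rule run_mono) (auto simp: chosen_time_def B_def[symmetric] algebra_simps)
qed

section \<open>Polynomial time bounds\<close>

definition is_poly :: "(nat \<Rightarrow> nat) \<Rightarrow> bool" where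
  "is_poly F \<longleftrightarrow> (\<exists>p. \<forall>n. F n = poly p n)"

lemma is_poly_id: "is_poly (\<lambda>n. n)"
  unfolding is_poly_def by (rule exI[of _ "[:0, 1:]"]) simp

lemma is_poly_const: "is_poly (\<lambda>n. c)"
  unfolding is_poly_def by (rule exI[of _ "[:c:]"]) simp

lemma is_poly_add: "is_poly F \<Longrightarrow> is_poly G \<Longrightarrow> is_poly (\<lambda>n. F n + G n)"
  unfolding is_poly_def by (metis poly_add)

lemma is_poly_mult: "is_poly F \<Longrightarrow> is_poly G \<Longrightarrow> is_poly (\<lambda>n. F n * G n)"
  unfolding is_poly_def by (metis poly_mult)

lemmas is_poly_intros = is_poly_id is_poly_const is_poly_add is_poly_mult

lemma is_poly_size_bound: "is_poly size_bound"
  unfolding size_bound_def[abs_def] by (intro is_poly_intros)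

text \<open>Unfolding the time functions leaves sums and products of constants and
  \<open>size_bound n\<close>, so closure under these two operations takes the place of
  composition.\<close>

lemma is_poly_to_minset_time: "is_poly (\<lambda>n. to_minset_time (size_bound n))"
  unfolding to_minset_time_def index_time_def select_time_def
  by (intro is_poly_intros is_poly_size_bound)

lemma is_poly_chosen_time: "is_poly (\<lambda>n. chosen_time (size_bound n))"
  unfolding chosen_time_def index_time_def select_time_def
  by (intro is_poly_intros is_poly_size_bound)

lemma poly_time_onI:
  assumes "is_poly F"
    and "\<And>x. x \<in> D \<Longrightarrow> run c (init_store (ei x)) (F (tsize (ei x))) (\<lambda>s. s 0 = eo (h x))"
  shows "poly_time_on D ei eo h"
  using assms unfolding poly_time_on_def is_poly_def run_def by metis

text \<open>The encoded instance lists its ground set, so the loop over the elements is a loop over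
  a part of the input.\<close>

lemma poly_time_to_minset:
  "poly_time_on (instances SetCover) (enc_inst SetCover) (enc_inst OfflineMinSet) to_minset"
proof (rule poly_time_onI[OF is_poly_to_minset_time])
  fix x assume "x \<in> instances SetCover"
  obtain n ss where x: "x = (n, ss)" by (cases x)
  let ?E = "enc_inst SetCover x"
  have E: "?E = Node (enc_list enc_nat [1..<Suc n]) (enc_sets ss)"
    by (simp add: x SetCover_def enc_prod_def del: upt_Suc)
  have "set [1..<Suc n] = {1..n}" by auto
  with run_to_minset_program[of "init_store ?E" "[1..<Suc n]" ss "tsize ?E"] E
  show "run to_minset_program (init_store ?E) (to_minset_time (size_bound (tsize ?E)))
      (\<lambda>s. s 0 = enc_inst OfflineMinSet (to_minset x))"
    by (simp add: init_store_def x to_minset_def OfflineMinSet_def enc_prod_def del: upt_Suc)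
qed

lemma poly_time_chosen:
  "poly_time_on D (enc_prod (enc_inst SetCover) (enc_sol OfflineMinSet)) (enc_sol SetCover)
     (\<lambda>(x, qs). chosen (snd x) qs)"
proof (rule poly_time_onI[OF is_poly_chosen_time])
  fix y :: "(nat \<times> nat list list) \<times> nat list"
  obtain n ss qs where y: "y = ((n, ss), qs)" by (cases y) auto
  let ?E = "enc_prod (enc_inst SetCover) (enc_sol OfflineMinSet) y"
  have "?E = Node (Node (enc_list enc_nat [1..<Suc n]) (enc_sets ss)) (enc_list enc_nat qs)"
    by (simp add: y SetCover_def OfflineMinSet_def enc_prod_def del: upt_Suc)
  with run_chosen_program[of "init_store ?E" "enc_list enc_nat [1..<Suc n]" ss qs "tsize ?E"]
  show "run chosen_program (init_store ?E) (chosen_time (size_bound (tsize ?E)))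
      (\<lambda>s. s 0 = enc_sol SetCover (case y of (x, qs) \<Rightarrow> chosen (snd x) qs))"
    by (simp add: init_store_def y SetCover_def del: upt_Suc)
qed


section \<open>Correctness of the reduction\<close>

text \<open>The shift \<open>j - 1\<close> arises because sets are indexed from 1 and list positions
  from 0.\<close>

lemma set_indexed: "set (indexed ss) = (\<lambda>j. (j, ss ! (j - 1))) ` {1..length ss}"
proof (induction ss rule: rev_induct)
  case (snoc S ss)
  have "(\<lambda>j. (j, (ss @ [S]) ! (j - 1))) ` {1..length ss} = (\<lambda>j. (j, ss ! (j - 1))) ` {1..length ss}"
    by (intro image_cong) (auto simp: nth_append)
  with snoc show ?case by (simp add: indexed_snoc atLeastAtMostSuc_conv)
qed (simp add: indexed_def)

lemma set_row: "set (row ss i) = {j \<in> {1..length ss}. i \<in> set (ss ! (j - 1))}"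
  by (auto simp: row_def set_indexed image_iff)

lemma set_chosen: "set (chosen ss qs) = (\<lambda>j. ss ! (j - 1)) ` ({1..length ss} \<inter> set qs)"
  by (force simp: chosen_def set_indexed image_iff)

lemma family_rows:
  "family (rows ss [1..<Suc n]) = insert {Suc (length ss)} ((\<lambda>i. set (row ss i)) ` {1..n})"
proof -
  have "set [1..<Suc n] = {1..n}" by auto
  then show ?thesis by (simp add: family_def rows_def image_image del: upt_Suc)
qed

section \<open>Feasible query sets as hitting sets of the rows\<close>

lemma interval_data:
  assumes "j \<in> {1..Suc m}"
  shows "lower_end (intervals m) j = (if j \<le> m then 0 else 1)"
    "upper_end (intervals m) j = (if j \<le> m then 2 else 1)" "weight (intervals m) j = 1"
  using assms
  by (auto simp: lower_end_def upper_end_def weight_def intervals_def nth_append set_interval_def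
      unit_interval_def)

text \<open>The singleton of the unit interval settles the existence of a certain optimum for every
  \<open>Q\<close>, so only the lower bounds of the rows impose a condition.\<close>

lemma minset_feasible_rows_iff:
  assumes nonempty: "\<forall>i\<in>{1..n}. row ss i \<noteq> []"
  defines "iv \<equiv> intervals (length ss)"
  shows "minset_feasible (length iv) (lower_end iv) (upper_end iv) (weight iv)
      (family (rows ss [1..<Suc n])) Q \<longleftrightarrow>
    Q \<subseteq> {1..Suc (length ss)} \<and> (\<forall>i\<in>{1..n}. set (row ss i) \<inter> Q \<noteq> {})"
proof -
  let ?m = "length ss" and ?F = "family (rows ss [1..<Suc n])"
  have sub: "set (row ss i) \<subseteq> {1..?m}" for i by (auto simp: set_row)
  have w: "(\<Sum>j\<in>S. weight iv j) = of_nat (card S)" if "S \<subseteq> {1..Suc ?m}" for S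
  proof -
    have "(\<Sum>j\<in>S. weight iv j) = (\<Sum>j\<in>S. 1)"
      using that by (intro sum.cong) (auto simp: iv_def interval_data)
    then show ?thesis by simp
  qed
  have card_row: "set_weight (weight iv) (set (row ss i)) \<ge> 1" if "i \<in> {1..n}" for i
  proof -
    have "card (set (row ss i)) \<ge> 1" using nonempty that by (simp add: Suc_le_eq card_gt_0_iff)
    moreover have "set (row ss i) \<subseteq> {1..Suc ?m}" using sub[of i] by auto
    ultimately show ?thesis by (simp add: set_weight_def w)
  qed
  have unit: "set_weight (weight iv) {Suc ?m} = 1"
    by (simp add: set_weight_def iv_def interval_data)
  have min: "min_weight (weight iv) ?F = 1"
    unfolding min_weight_def family_rows by (rule Min_eqI) (use card_row unit in auto)
  \<comment> \<open>Unqueried indices contribute the lower end 0, queried ones the weight 1.\<close>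
  have row: "queried_bound (lower_end iv) (weight iv) (set (row ss i)) Q = of_nat (card (set (row ss i) \<inter> Q))" for i
  proof -
    have "(\<Sum>j\<in>set (row ss i) - Q. lower_end iv j) = 0"
    proof (rule sum.neutral, rule ballI)
      fix j assume "j \<in> set (row ss i) - Q"
      then have "j \<in> {1..?m}" using sub by blast
      then show "lower_end iv j = 0" by (simp add: iv_def interval_data)
    qed
    moreover have "set (row ss i) \<inter> Q \<subseteq> {1..Suc ?m}" using sub[of i] by auto
    ultimately show ?thesis by (simp add: queried_bound_def w)
  qed
  \<comment> \<open>Both ends and the weight of the unit interval are 1, so querying it changes
    nothing.\<close>
  have unit_bounds: "queried_bound (lower_end iv) (weight iv) {Suc ?m} Q = 1"
    "queried_bound (upper_end iv) (weight iv) {Suc ?m} Q = 1"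
    by (cases "Suc ?m \<in> Q"; simp add: queried_bound_def iv_def interval_data Int_insert_left insert_Diff_if)+
  have "length iv = Suc ?m" by (simp add: iv_def intervals_def)
  moreover have "1 \<le> (of_nat (card (set (row ss i) \<inter> Q)) :: rat) \<longleftrightarrow> set (row ss i) \<inter> Q \<noteq> {}" for i
  proof -
    have "1 \<le> (of_nat (card (set (row ss i) \<inter> Q)) :: rat) \<longleftrightarrow> 1 \<le> card (set (row ss i) \<inter> Q)"
      by (metis of_nat_1 of_nat_le_iff)
    also have "\<dots> \<longleftrightarrow> set (row ss i) \<inter> Q \<noteq> {}" by (simp add: Suc_le_eq card_gt_0_iff)
    finally show ?thesis .
  qed
  ultimately show ?thesis
    unfolding minset_feasible_def min unfolding family_rows by (simp add: row unit_bounds)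
qed

text \<open>If some row is empty, the family is empty and nothing is feasible, while on the right no
  set meets that row. Hence one description serves both cases.\<close>

lemma solutions_to_minset:
  "qs \<in> solutions OfflineMinSet (to_minset (n, ss)) \<longleftrightarrow>
    set qs \<subseteq> {1..Suc (length ss)} \<and> (\<forall>i\<in>{1..n}. set (row ss i) \<inter> set qs \<noteq> {})"
proof (cases "\<exists>i\<in>{1..n}. row ss i = []")
  case True
  then have "qs \<notin> solutions OfflineMinSet (to_minset (n, ss))"
    by (simp add: OfflineMinSet_def to_minset_def minset_feasible_def family_def)
  moreover obtain i where "i \<in> {1..n}" "set (row ss i) \<inter> set qs = {}" using True by auto
  ultimately show ?thesis by blast
next
  case False
  then show ?thesis
    using minset_feasible_rows_iff[of n ss "set qs"]
    by (simp add: OfflineMinSet_def to_minset_def del: upt_Suc)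
qed

lemma to_minset_in_instances: "to_minset (n, ss) \<in> instances OfflineMinSet"
proof -
  let ?iv = "intervals (length ss)"
  have len: "length ?iv = Suc (length ss)" by (simp add: intervals_def)
  have "valid_interval (lower_end ?iv j) (upper_end ?iv j) (weight ?iv j)"
    if "j \<in> {1..length ?iv}" for j
    using that by (auto simp: len interval_data valid_interval_def)
  moreover have "family (rows ss [1..<Suc n]) \<subseteq> Pow {1..length ?iv}"
    unfolding family_rows len by (auto simp: set_row)
  ultimately show ?thesis
    by (auto simp: OfflineMinSet_def to_minset_def family_def[of "[]"] simp del: upt_Suc)
qed

text \<open>One index for each set of a cover gives a feasible query set that is no larger. Without
  a cover the right-hand side is infinite.\<close>

lemma OPT_to_minset_le: "OPT OfflineMinSet (to_minset (n, ss)) \<le> OPT SetCover (n, ss)"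
  unfolding OPT_def
proof (rule INF_greatest)
  fix hs assume "hs \<in> solutions SetCover (n, ss)"
  then have sub: "family hs \<subseteq> family ss" and un: "\<Union>(family hs) = {1..n}"
    by (auto simp: SetCover_def is_cover_def)
  have "\<forall>S\<in>family hs. \<exists>j\<in>{1..length ss}. set (ss ! (j - 1)) = S"
  proof
    fix S assume "S \<in> family hs"
    then obtain xs where "xs \<in> set ss" "S = set xs" using sub by (auto simp: family_def)
    then obtain k where "k < length ss" "set (ss ! k) = S" by (auto simp: in_set_conv_nth)
    then show "\<exists>j\<in>{1..length ss}. set (ss ! (j - 1)) = S" by (intro bexI[of _ "Suc k"]) auto
  qed
  \<comment> \<open>A set repeated in \<open>ss\<close> has several indices; \<open>idx\<close>
    picks one for each distinct set, as the cost counts distinct sets.\<close>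
  then obtain idx where idx: "\<And>S. S \<in> family hs \<Longrightarrow> idx S \<in> {1..length ss} \<and> set (ss ! (idx S - 1)) = S"
    by metis
  have fin: "finite (family hs)" by (simp add: family_def)
  then obtain qs where qs: "set qs = idx ` family hs"
    using finite_list[OF finite_imageI, of "family hs" idx] by blast
  have "set (row ss i) \<inter> set qs \<noteq> {}" if "i \<in> {1..n}" for i
  proof -
    have "i \<in> \<Union>(family hs)" using that by (simp only: un)
    then obtain S where "S \<in> family hs" "i \<in> S" by (rule UnionE)
    then have "idx S \<in> set (row ss i) \<inter> set qs" using idx[of S] by (simp add: set_row qs)
    then show ?thesis by blast
  qed
  moreover have "set qs \<subseteq> {1..Suc (length ss)}" unfolding qs using idx by fastforce
  ultimately have "qs \<in> solutions OfflineMinSet (to_minset (n, ss))"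
    by (simp add: solutions_to_minset)
  moreover have "cost OfflineMinSet (to_minset (n, ss)) qs \<le> cost SetCover (n, ss) hs"
    using card_image_le[OF fin] by (simp add: OfflineMinSet_def SetCover_def qs)
  ultimately show "(INF qs\<in>solutions OfflineMinSet (to_minset (n, ss)).
      enat (cost OfflineMinSet (to_minset (n, ss)) qs)) \<le> enat (cost SetCover (n, ss) hs)"
    by (intro INF_lower2) auto
qed

text \<open>A queried index in the row of \<open>i\<close> names a chosen set containing
  \<open>i\<close>. That no other elements are covered follows from the condition on
  instances.\<close>

lemma chosen_cover:
  assumes "(n, ss) \<in> instances SetCover" "qs \<in> solutions OfflineMinSet (to_minset (n, ss))"
  shows "chosen ss qs \<in> solutions SetCover (n, ss)"
proof -
  have sub: "family (chosen ss qs) \<subseteq> family ss" by (auto simp: family_def set_chosen)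
  moreover have "family ss \<subseteq> Pow {1..n}" using assms(1) by (simp add: SetCover_def)
  moreover have "\<exists>S\<in>family (chosen ss qs). i \<in> S" if "i \<in> {1..n}" for i
  proof -
    have "set (row ss i) \<inter> set qs \<noteq> {}" using assms(2) that by (simp add: solutions_to_minset)
    then obtain j where "j \<in> {1..length ss} \<inter> set qs" "i \<in> set (ss ! (j - 1))"
      by (auto simp: set_row)
    then show ?thesis by (auto simp: family_def set_chosen)
  qed
  ultimately show ?thesis by (auto simp: SetCover_def is_cover_def)
qed

text \<open>The chosen sets are an image of a part of the query set: different indices may name the
  same set, and the unit interval names none.\<close>

lemma cost_chosen_le: "cost SetCover x (chosen ss qs) \<le> cost OfflineMinSet y qs"
proof -
  have "family (chosen ss qs) = (\<lambda>j. set (ss ! (j - 1))) ` ({1..length ss} \<inter> set qs)"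
    by (simp add: family_def set_chosen image_image)
  then have "card (family (chosen ss qs)) \<le> card ({1..length ss} \<inter> set qs)"
    by (simp add: card_image_le)
  also have "\<dots> \<le> card (set qs)" by (simp add: card_mono)
  finally show ?thesis by (simp add: SetCover_def OfflineMinSet_def)
qed

theorem theorem10:
  "\<exists>f g. approx_factor_preserving_reduction SetCover OfflineMinSet f g"
proof (intro exI)
  show "approx_factor_preserving_reduction SetCover OfflineMinSet to_minset (\<lambda>x. chosen (snd x))"
    unfolding approx_factor_preserving_reduction_def
  proof (intro conjI ballI poly_time_to_minset poly_time_chosen)
    fix x assume "x \<in> instances SetCover"
    moreover obtain n ss where x: "x = (n, ss)" by (cases x)
    ultimately show "to_minset x \<in> instances OfflineMinSet"
      "OPT OfflineMinSet (to_minset x) \<le> OPT SetCover x"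
      "\<And>qs. qs \<in> solutions OfflineMinSet (to_minset x) \<Longrightarrow> chosen (snd x) qs \<in> solutions SetCover x"
      "\<And>qs. cost SetCover x (chosen (snd x) qs) \<le> cost OfflineMinSet (to_minset x) qs"
      by (auto simp: to_minset_in_instances OPT_to_minset_le cost_chosen_le intro: chosen_cover)
  qed
qed

end
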